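(* Let $r\in\mathbb{R}^2$ be a root, $t_1,\dots,t_n\in\mathbb{R}^2$ terminals, and let $0<\alpha<\pi/2$ be a restricting angle. Then every optimal flux tree for this input consists of straight line segments and segments of logarithmic spirals (left or right spirals of angle $\alpha$ centered at $r$).
   Context: The root $r$ is placed at the origin. A curve directed towards $r$ is angle-restricted if at every point $p\neq r$ of it the angle between the tangent vector of the curve at $p$ (in the direction of travel; one-sided tangents at breakpoints) and the vector from $p$ to $r$ is at most $\alpha$. A flux tree (angle-restricted Steiner arborescence) for root $r$ and terminals $t_1,\dots,t_n$ is a finite tree drawn in the plane, rooted at $r$, whose nodes include $r$ and all terminals and possibly additional (Steiner) nodes, whose arcs are rectifiable curves (piecewise smooth away from $r$) directed from the terminals towards the root, all of them angle-restricted. Its length is the sum of the lengths of its arcs; an optimal flux tree is one of minimum length. For a point $p$ with polar coordinates $(R,\phi)$ the right spiral $\mathcal{S}^+_p$ is given in polar coordinates by $R(t)=Re^{-t}$, $\phi(t)=\phi+\tan(\alpha)\,t$, and the left spiral $\mathcal{S}^-_p$ is given by the same equations with $\alpha$ replaced by $-\alpha$. A spiral segment is a connected piece of a right or left spiral (possibly including the limit endpoint $r$). *)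

theory Defs
  imports "HOL-Analysis.Analysis"
begin

text \<open>The plane is the type \<^typ>\<open>complex\<close>. A curve is a function on the unit interval, traversed
  in the direction of increasing parameter. The root \<open>r\<close> is an arbitrary point, so polar
  coordinates are taken around \<open>r\<close>.\<close>

definition subdivision :: "real \<Rightarrow> real \<Rightarrow> nat \<Rightarrow> (nat \<Rightarrow> real) \<Rightarrow> bool" where
  "subdivision a b m s \<longleftrightarrow> s 0 = a \<and> s m = b \<and> (\<forall>i<m. s i < s (Suc i))"

definition polygonal_lengths :: "(real \<Rightarrow> complex) \<Rightarrow> real set" where
  "polygonal_lengths g =
     {(\<Sum>i<m. dist (g (s i)) (g (s (Suc i)))) | m s. subdivision 0 1 m s}"

definition rectifiable :: "(real \<Rightarrow> complex) \<Rightarrow> bool" where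
  "rectifiable g \<longleftrightarrow> bdd_above (polygonal_lengths g)"

definition curve_length :: "(real \<Rightarrow> complex) \<Rightarrow> real" where
  "curve_length g = Sup (polygonal_lengths g)"

text \<open>Smooth means regular of class \<open>C\<^sup>1\<close>, with one-sided derivatives at the ends of the interval,
  so that a piecewise smooth curve has one-sided tangents at its breakpoints.\<close>

definition smooth_between :: "(real \<Rightarrow> complex) \<Rightarrow> real \<Rightarrow> real \<Rightarrow> bool" where
  "smooth_between g a b \<longleftrightarrow>
     (\<exists>g'. continuous_on {a..b} g' \<and>
        (\<forall>t\<in>{a..b}. g' t \<noteq> 0 \<and> (g has_vector_derivative g' t) (at t within {a..b})))"

definition piecewise_smooth_between :: "(real \<Rightarrow> complex) \<Rightarrow> real \<Rightarrow> real \<Rightarrow> bool" where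
  "piecewise_smooth_between g a b \<longleftrightarrow>
     (\<exists>m s. subdivision a b m s \<and> (\<forall>i<m. smooth_between g (s i) (s (Suc i))))"

text \<open>Breakpoints may accumulate at \<open>r\<close>, and no tangent is required there.\<close>

definition piecewise_smooth_away_from :: "complex \<Rightarrow> (real \<Rightarrow> complex) \<Rightarrow> bool" where
  "piecewise_smooth_away_from r g \<longleftrightarrow>
     (\<forall>a b. 0 \<le> a \<and> a < b \<and> b \<le> 1 \<and> r \<notin> g ` {a..b} \<longrightarrow> piecewise_smooth_between g a b)"

definition angle_between :: "complex \<Rightarrow> complex \<Rightarrow> real" where
  "angle_between u v = arccos ((u \<bullet> v) / (norm u * norm v))"

definition one_sided_tangent :: "(real \<Rightarrow> complex) \<Rightarrow> real \<Rightarrow> complex \<Rightarrow> bool" where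
  "one_sided_tangent g t d \<longleftrightarrow>
     (t < 1 \<and> (g has_vector_derivative d) (at t within {t..1})) \<or>
     (0 < t \<and> (g has_vector_derivative d) (at t within {0..t}))"

definition angle_restricted :: "real \<Rightarrow> complex \<Rightarrow> (real \<Rightarrow> complex) \<Rightarrow> bool" where
  "angle_restricted \<alpha> r g \<longleftrightarrow>
     (\<forall>t\<in>{0..1}. \<forall>d. g t \<noteq> r \<and> one_sided_tangent g t d \<longrightarrow> angle_between d (r - g t) \<le> \<alpha>)"

text \<open>A tree rooted at \<open>r\<close> with all arcs directed towards the root: \<open>V\<close> is the set of nodes
  (points of the plane), \<open>E\<close> the set of arcs.\<close>

definition tree_towards :: "complex \<Rightarrow> complex set \<Rightarrow> (complex \<times> complex) set \<Rightarrow> bool" where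
  "tree_towards r V E \<longleftrightarrow>
     finite V \<and> r \<in> V \<and> E \<subseteq> V \<times> V \<and>
     (\<forall>w. (r, w) \<notin> E) \<and> (\<forall>v\<in>V - {r}. \<exists>!w. (v, w) \<in> E) \<and>
     (\<forall>v\<in>V. (v, r) \<in> E\<^sup>*)"

text \<open>The curve \<open>c e\<close> draws the arc \<open>e\<close>. Arcs may cross or overlap.\<close>

definition flux_tree ::
  "real \<Rightarrow> complex \<Rightarrow> complex set \<Rightarrow> complex set \<Rightarrow> (complex \<times> complex) set \<Rightarrow>
   (complex \<times> complex \<Rightarrow> real \<Rightarrow> complex) \<Rightarrow> bool" where
  "flux_tree \<alpha> r T V E c \<longleftrightarrow>
     tree_towards r V E \<and> T \<subseteq> V \<and>
     (\<forall>(v, w)\<in>E. path (c (v, w)) \<and> pathstart (c (v, w)) = v \<and> pathfinish (c (v, w)) = w \<and>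
        rectifiable (c (v, w)) \<and> piecewise_smooth_away_from r (c (v, w)) \<and>
        angle_restricted \<alpha> r (c (v, w)))"

definition tree_length ::
  "(complex \<times> complex) set \<Rightarrow> (complex \<times> complex \<Rightarrow> real \<Rightarrow> complex) \<Rightarrow> real" where
  "tree_length E c = (\<Sum>e\<in>E. curve_length (c e))"

definition optimal_flux_tree ::
  "real \<Rightarrow> complex \<Rightarrow> complex set \<Rightarrow> complex set \<Rightarrow> (complex \<times> complex) set \<Rightarrow>
   (complex \<times> complex \<Rightarrow> real \<Rightarrow> complex) \<Rightarrow> bool" where
  "optimal_flux_tree \<alpha> r T V E c \<longleftrightarrow>
     flux_tree \<alpha> r T V E c \<and>
     (\<forall>V' E' c'. flux_tree \<alpha> r T V' E' c' \<longrightarrow> tree_length E c \<le> tree_length E' c')"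

text \<open>The right spiral through \<open>p\<close> is \<open>spiral \<alpha> r p\<close>, the left spiral is \<open>spiral (- \<alpha>) r p\<close>.\<close>

definition spiral :: "real \<Rightarrow> complex \<Rightarrow> complex \<Rightarrow> real \<Rightarrow> complex" where
  "spiral \<alpha> r p t = r + rcis (cmod (p - r) * exp (- t)) (Arg (p - r) + tan \<alpha> * t)"

definition line_segment :: "complex set \<Rightarrow> bool" where
  "line_segment A \<longleftrightarrow> (\<exists>a b. a \<noteq> b \<and> A = closed_segment a b)"

definition spiral_segment :: "real \<Rightarrow> complex \<Rightarrow> complex set \<Rightarrow> bool" where
  "spiral_segment \<alpha> r A \<longleftrightarrow>
     (\<exists>p \<beta> a b. p \<noteq> r \<and> \<beta> \<in> {\<alpha>, - \<alpha>} \<and> 0 \<le> a \<and> a < b \<and>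
        (A = spiral \<beta> r p ` {a..b} \<or> A = insert r (spiral \<beta> r p ` {a..})))"

definition consists_of_segments :: "real \<Rightarrow> complex \<Rightarrow> (real \<Rightarrow> complex) \<Rightarrow> bool" where
  "consists_of_segments \<alpha> r g \<longleftrightarrow>
     (\<exists>m s. subdivision 0 1 m s \<and>
        (\<forall>i<m. line_segment (g ` {s i..s (Suc i)}) \<or> spiral_segment \<alpha> r (g ` {s i..s (Suc i)})))"

end

theory Submission
  imports Defs
begin

text \<open>Every arc of an optimal flux tree is a shortest angle-restricted curve \<open>g\<close> between its ends. An
  arc into \<open>r\<close> is therefore straight. Any other arc avoids \<open>r\<close>, so it can be written in logarithmic
  polar coordinates as \<open>g = r + exp q\<close>; the angle restriction then reads
  \<open>\<bar>Im q'\<bar> \<le> - tan \<alpha> * Re q'\<close>, and length is \<open>\<integral> exp (Re q) * \<bar>q'\<bar>\<close>, which depends on the slope of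
  \<open>q\<close> in a strictly convex way. Consider the curve that makes the angle with sine
  \<open>min (sin \<alpha>) (d / R)\<close> with the direction to \<open>r\<close> at distance \<open>R\<close>: a line at distance \<open>d\<close> from \<open>r\<close>,
  followed by a tangent spiral. By the intermediate value theorem \<open>d\<close> can be chosen so that this curve
  joins the ends of \<open>g\<close>. Convexity provides a calibrating potential whose increase along an
  admissible curve is at most its length, and equal to it only if the slope is that of the
  comparison curve everywhere. Minimality of \<open>g\<close> forces equality.\<close>

section \<open>One-sided derivatives and lengths\<close>

text \<open>\<open>S\<close> is the part of the interval on one side of \<open>t\<close>, so \<open>at t within S\<close> is a one-sided limit.\<close>

definition side :: "real \<Rightarrow> real \<Rightarrow> real \<Rightarrow> real set \<Rightarrow> bool" where
  "side a b t S \<longleftrightarrow> (a \<le> t \<and> t < b \<and> S = {t..b}) \<or> (a < t \<and> t \<le> b \<and> S = {a..t})"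

lemma side_subinterval:
  assumes "side a b t S" "a' \<le> a" "b \<le> b'"
  obtains S' where "side a' b' t S'" "S \<subseteq> S'"
  using assms unfolding side_def by fastforce

lemma side_mem: "side a b t S \<Longrightarrow> t \<in> {a..b}"
  by (auto simp: side_def)

lemma side_subset: "side a b t S \<Longrightarrow> S \<subseteq> {a..b}"
  by (auto simp: side_def)

lemma side_nontrivial: "side a b t S \<Longrightarrow> at t within S \<noteq> bot"
  by (auto simp: side_def at_within_Icc_at_right at_within_Icc_at_left)

text \<open>Bisection on the compact interval. At a point \<open>t\<close> the two one-sided steps
  give radii \<open>d1\<close> and \<open>d2\<close>, and a short interval containing
  \<open>t\<close> is glued at \<open>t\<close> by \<open>trans\<close>. Writing the step with
  \<open>min t y\<close> and \<open>max t y\<close> states the left and the right case at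
  once.\<close>

lemma side_induct:
  fixes P :: "real \<Rightarrow> real \<Rightarrow> bool"
  assumes "a < b"
    and trans: "\<And>x y z. a \<le> x \<Longrightarrow> x < y \<Longrightarrow> y < z \<Longrightarrow> z \<le> b \<Longrightarrow> P x y \<Longrightarrow> P y z \<Longrightarrow> P x z"
    and step: "\<And>t S. side a b t S \<Longrightarrow> \<forall>\<^sub>F y in at t within S. P (min t y) (max t y)"
  shows "P a b"
proof -
  \<comment> \<open>The guard makes \<open>Q\<close> hold trivially on degenerate or protruding
    intervals, which \<open>Bolzano\<close> also ranges over.\<close>
  define Q where "Q x y \<longleftrightarrow> (a \<le> x \<and> x < y \<and> y \<le> b \<longrightarrow> P x y)" for x y
  have "Q a b"
  proof (rule Bolzano)
    show "a \<le> b" using \<open>a < b\<close> by simp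
    show "Q x z" if "Q x y" "Q y z" "x \<le> y" "y \<le> z" for x y z
      using that trans[of x y z] unfolding Q_def by (cases "x = y"; cases "y = z") auto
    fix t assume t: "a \<le> t" "t \<le> b"
    have "\<exists>d>0. \<forall>y. t < y \<and> y \<le> b \<and> y - t < d \<longrightarrow> P t y"
    proof (cases "t < b")
      case True
      then have "side a b t {t..b}" using t by (simp add: side_def)
      from step[OF this] obtain d where "d > 0"
        and d: "\<And>y. y \<in> {t..b} \<Longrightarrow> y \<noteq> t \<Longrightarrow> dist y t < d \<Longrightarrow> P (min t y) (max t y)"
        unfolding eventually_at by blast
      have "P t y" if "t < y" "y \<le> b" "y - t < d" for y
        using d[of y] that by (simp add: dist_real_def min_def max_def split: if_splits)
      with \<open>d > 0\<close> show ?thesis by blast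
    qed (auto intro: exI[of _ 1])
    then obtain d1 where d1: "d1 > 0" "\<And>y. t < y \<Longrightarrow> y \<le> b \<Longrightarrow> y - t < d1 \<Longrightarrow> P t y" by blast
    have "\<exists>d>0. \<forall>y. y < t \<and> a \<le> y \<and> t - y < d \<longrightarrow> P y t"
    proof (cases "a < t")
      case True
      then have "side a b t {a..t}" using t by (simp add: side_def)
      from step[OF this] obtain d where "d > 0"
        and d: "\<And>y. y \<in> {a..t} \<Longrightarrow> y \<noteq> t \<Longrightarrow> dist y t < d \<Longrightarrow> P (min t y) (max t y)"
        unfolding eventually_at by blast
      have "P y t" if "y < t" "a \<le> y" "t - y < d" for y
        using d[of y] that by (simp add: dist_real_def min_def max_def split: if_splits)
      with \<open>d > 0\<close> show ?thesis by blast
    qed (auto intro: exI[of _ 1])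
    then obtain d2 where d2: "d2 > 0" "\<And>y. y < t \<Longrightarrow> a \<le> y \<Longrightarrow> t - y < d2 \<Longrightarrow> P y t" by blast
    have "Q x y" if xy: "x \<le> t" "t \<le> y" "y - x < min d1 d2" for x y
      unfolding Q_def
    proof
      assume *: "a \<le> x \<and> x < y \<and> y \<le> b"
      consider "x = t" | "y = t" | "x < t" "t < y" using xy by linarith
      then show "P x y"
        using * xy d1(2)[of y] d2(2)[of x] trans[of x t y] by cases auto
    qed
    then show "\<exists>d>0. \<forall>x y. x \<le> t \<and> t \<le> y \<and> y - x < d \<longrightarrow> Q x y"
      using d1(1) d2(1) by (intro exI[of _ "min d1 d2"]) auto
  qed
  with \<open>a < b\<close> show ?thesis by (simp add: Q_def)
qed

text \<open>The increment is taken in the direction of increasing parameter on either side of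
  \<open>t\<close>, so a single estimate serves both one-sided derivatives in
  \<open>side_induct\<close>.\<close>

lemma eventually_increment:
  fixes f :: "real \<Rightarrow> 'a::real_normed_vector"
  assumes "(f has_vector_derivative D) (at t within S)" "e > 0"
  shows "\<forall>\<^sub>F y in at t within S. norm (f (max t y) - f (min t y) - \<bar>y - t\<bar> *\<^sub>R D) \<le> e * \<bar>y - t\<bar>"
proof -
  obtain d where "d > 0" and d: "\<And>y. y \<in> S \<Longrightarrow> \<bar>y - t\<bar> < d \<Longrightarrow>
      norm (f y - f t - (y - t) *\<^sub>R D) \<le> e * \<bar>y - t\<bar>"
    using assms unfolding has_vector_derivative_def has_derivative_within_alt real_norm_def by blast
  have "norm (f (max t y) - f (min t y) - \<bar>y - t\<bar> *\<^sub>R D) \<le> e * \<bar>y - t\<bar>"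
    if "y \<in> S" "dist y t < d" for y
  proof (cases "t \<le> y")
    case True
    then show ?thesis using d[of y] that by (simp add: dist_real_def)
  next
    case False
    then have "f (max t y) - f (min t y) - \<bar>y - t\<bar> *\<^sub>R D = - (f y - f t - (y - t) *\<^sub>R D)"
      by (simp add: algebra_simps)
    then show ?thesis using d[of y] that by (metis dist_real_def norm_minus_cancel)
  qed
  then show ?thesis unfolding eventually_at using \<open>d > 0\<close> by blast
qed

lemma eventually_at_neq: "\<forall>\<^sub>F y in at t within S. y \<noteq> t"
  by (simp add: eventually_at_filter)

text \<open>At breakpoints the left and right derivatives may differ, so the mean value theorem does
  not apply directly. Strict decrease is transitive and holds locally on each side, which is what
  \<open>side_induct\<close> asks for.\<close>

lemma strict_decreasing_if_side_derivatives_neg: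
  fixes f :: "real \<Rightarrow> real"
  assumes "a < b"
    and der: "\<And>t S. side a b t S \<Longrightarrow> \<exists>D<0. (f has_vector_derivative D) (at t within S)"
  shows "f b < f a"
proof (rule side_induct[OF \<open>a < b\<close>, where P = "\<lambda>x y. f y < f x"])
  fix t S assume "side a b t S"
  from der[OF this] obtain D where D: "D < 0" "(f has_vector_derivative D) (at t within S)" by blast
  \<comment> \<open>An error of half the slope still leaves a negative increment of at most
    \<open>D / 2 * \<bar>y - t\<bar>\<close>.\<close>
  from eventually_increment[OF D(2), of "- D / 2"] D(1)
  have "\<forall>\<^sub>F y in at t within S. norm (f (max t y) - f (min t y) - \<bar>y - t\<bar> *\<^sub>R D) \<le> - D / 2 * \<bar>y - t\<bar>"
    by simp
  with eventually_at_neq show "\<forall>\<^sub>F y in at t within S. f (max t y) < f (min t y)"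
  proof eventually_elim
    case (elim y)
    have "f (max t y) - f (min t y) \<le> \<bar>y - t\<bar> * D + - D / 2 * \<bar>y - t\<bar>"
      using elim(2) unfolding real_norm_def real_scaleR_def abs_le_iff by argo
    also have "\<dots> = D / 2 * \<bar>y - t\<bar>" by (simp add: algebra_simps)
    also have "\<dots> < 0" using D(1) elim(1) by (simp add: mult_neg_pos)
    finally show ?case by simp
  qed
qed auto

lemma decreasing_if_side_derivatives_nonpos:
  fixes f :: "real \<Rightarrow> real"
  assumes "a \<le> b"
    and der: "\<And>t S. side a b t S \<Longrightarrow> \<exists>D\<le>0. (f has_vector_derivative D) (at t within S)"
  shows "f b \<le> f a"
proof (cases "a < b")
  case True
  have "f b - f a \<le> 0 + e" if "e > 0" for e
  proof -
    \<comment> \<open>Subtracting a line of small slope \<open>k\<close> makes the derivatives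
      strictly negative, at a total cost of \<open>e\<close> over the interval.\<close>
    define k where "k = e / (b - a)"
    have "k > 0" using that True by (simp add: k_def)
    have "f b - k * b < f a - k * a"
    proof (rule strict_decreasing_if_side_derivatives_neg[OF True])
      fix t S assume "side a b t S"
      from der[OF this] obtain D where D: "D \<le> 0" "(f has_vector_derivative D) (at t within S)"
        by blast
      then have "((\<lambda>x. f x - k * x) has_vector_derivative D - k) (at t within S)"
        by (auto intro!: derivative_eq_intros)
      with D \<open>k > 0\<close> show "\<exists>D<0. ((\<lambda>x. f x - k * x) has_vector_derivative D) (at t within S)"
        by (intro exI[of _ "D - k"]) auto
    qed
    then have "f b - f a < k * (b - a)" by (simp add: algebra_simps)
    then show ?thesis using True by (simp add: k_def)
  qed
  then have "f b - f a \<le> 0" by (rule field_le_epsilon)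
  then show ?thesis by simp
qed (use assms(1) in auto)

lemma constant_if_side_derivatives_zero:
  fixes f :: "real \<Rightarrow> real"
  assumes "a \<le> b"
    and der: "\<And>t S. side a b t S \<Longrightarrow> (f has_vector_derivative 0) (at t within S)"
  shows "f b = f a"
proof (rule antisym)
  show "f b \<le> f a"
    by (rule decreasing_if_side_derivatives_nonpos[OF assms(1)]) (use der in blast)
  have "- f b \<le> - f a"
    using has_vector_derivative_minus[OF der]
    by (intro decreasing_if_side_derivatives_nonpos[OF assms(1), of "\<lambda>x. - f x"]) force
  then show "f a \<le> f b" by simp
qed

section \<open>Inscribed polygons and curve length\<close>

lemma subdivision_append:
  assumes "subdivision a b m s" "subdivision b c n s'"
  obtains s'' where "subdivision a c (m + n) s''"
    "(\<Sum>i<m + n. dist (g (s'' i)) (g (s'' (Suc i)))) =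
      (\<Sum>i<m. dist (g (s i)) (g (s (Suc i)))) + (\<Sum>i<n. dist (g (s' i)) (g (s' (Suc i))))"
proof
  define u where "u i = (if i \<le> m then s i else s' (i - m))" for i
  have u1: "u i = s i" if "i \<le> m" for i using that by (simp add: u_def)
  have u2: "u (m + i) = s' i" for i
    using assms by (auto simp: u_def subdivision_def)
  have u3: "u (Suc (m + i)) = s' (Suc i)" for i using u2[of "Suc i"] by simp
  show "subdivision a c (m + n) u"
    unfolding subdivision_def
  proof (intro conjI allI impI)
    show "u 0 = a" "u (m + n) = c" using assms u1[of 0] u2[of n] by (auto simp: subdivision_def)
    fix i assume i: "i < m + n"
    show "u i < u (Suc i)"
    proof (cases "i < m")
      case True
      then show ?thesis using assms u1 by (simp add: subdivision_def)
    next
      case False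
      then obtain j where "i = m + j" by (metis not_less le_Suc_ex)
      then show ?thesis using assms i u2 u3 by (simp add: subdivision_def)
    qed
  qed
  show "(\<Sum>i<m + n. dist (g (u i)) (g (u (Suc i)))) =
      (\<Sum>i<m. dist (g (s i)) (g (s (Suc i)))) + (\<Sum>i<n. dist (g (s' i)) (g (s' (Suc i))))"
  proof -
    have "(\<Sum>i<m + n. dist (g (u i)) (g (u (Suc i)))) =
        (\<Sum>i<m. dist (g (u i)) (g (u (Suc i)))) + (\<Sum>i<n. dist (g (u (m + i))) (g (u (Suc (m + i)))))"
      by (induction n) (auto simp: algebra_simps)
    also have "(\<Sum>i<m. dist (g (u i)) (g (u (Suc i)))) = (\<Sum>i<m. dist (g (s i)) (g (s (Suc i))))"
      by (intro sum.cong) (auto simp: u1)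
    finally show ?thesis by (simp add: u2 u3)
  qed
qed

lemma subdivision_single: "a < b \<Longrightarrow> subdivision a b 1 (\<lambda>i. if i = 0 then a else b)"
  by (simp add: subdivision_def)

text \<open>The infinitesimal inequality \<open>f' \<le> \<bar>g'\<bar>\<close> at every one-sided tangent integrates to the length
  of inscribed polygons, without any regularity of the derivatives.\<close>

lemma exists_inscribed_polygon:
  fixes f :: "real \<Rightarrow> real"
  assumes "a \<le> b" "e > 0"
    and der: "\<And>t S. side a b t S \<Longrightarrow> \<exists>D d. (f has_vector_derivative D) (at t within S) \<and>
      (g has_vector_derivative d) (at t within S) \<and> D \<le> norm d"
  obtains m s where "subdivision a b m s"
    "f b - f a \<le> (\<Sum>i<m. dist (g (s i)) (g (s (Suc i)))) + e * (b - a)"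
proof -
  define P where "P x y \<longleftrightarrow> (\<exists>m s. subdivision x y m s \<and>
      f y - f x \<le> (\<Sum>i<m. dist (g (s i)) (g (s (Suc i)))) + e * (y - x))" for x y
  have "P a b"
  proof (cases "a < b")
    case True
    then show ?thesis
    proof (rule side_induct)
      fix x y z assume "P x y" "P y z"
      from this(1) obtain m s where 1: "subdivision x y m s"
        "f y - f x \<le> (\<Sum>i<m. dist (g (s i)) (g (s (Suc i)))) + e * (y - x)"
        unfolding P_def by blast
      from \<open>P y z\<close> obtain n s' where 2: "subdivision y z n s'"
        "f z - f y \<le> (\<Sum>i<n. dist (g (s' i)) (g (s' (Suc i)))) + e * (z - y)"
        unfolding P_def by blast
      obtain s'' where 3: "subdivision x z (m + n) s''"
        "(\<Sum>i<m + n. dist (g (s'' i)) (g (s'' (Suc i)))) =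
          (\<Sum>i<m. dist (g (s i)) (g (s (Suc i)))) + (\<Sum>i<n. dist (g (s' i)) (g (s' (Suc i))))"
        using subdivision_append[OF 1(1) 2(1)] by blast
      have "f z - f x \<le> (\<Sum>i<m + n. dist (g (s'' i)) (g (s'' (Suc i)))) + e * (z - x)"
        using 1(2) 2(2) unfolding 3(2) by (simp add: algebra_simps)
      with 3(1) show "P x z" unfolding P_def by blast
    next
      fix t S assume "side a b t S"
      from der[OF this] obtain D d where D: "(f has_vector_derivative D) (at t within S)"
        and d: "(g has_vector_derivative d) (at t within S)" and le: "D \<le> norm d" by blast
      \<comment> \<open>The error is shared equally between the estimates for \<open>f\<close> and
        for \<open>g\<close>.\<close>
      have "e / 2 > 0" using \<open>e > 0\<close> by simp
      from eventually_at_neq eventually_increment[OF D this] eventually_increment[OF d this]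
      show "\<forall>\<^sub>F y in at t within S. P (min t y) (max t y)"
      proof eventually_elim
        case (elim y)
        let ?x = "min t y" and ?y = "max t y"
        have "?x < ?y" using elim(1) by auto
        have yx: "?y - ?x = \<bar>y - t\<bar>" by auto
        have "f ?y - f ?x \<le> \<bar>y - t\<bar> * D + e / 2 * \<bar>y - t\<bar>"
          using elim(2) unfolding real_norm_def real_scaleR_def abs_le_iff by argo
        also have "\<bar>y - t\<bar> * D \<le> \<bar>y - t\<bar> * norm d" by (intro mult_left_mono le) auto
        also have "\<bar>y - t\<bar> * norm d = norm (\<bar>y - t\<bar> *\<^sub>R d)" by simp
        also have "\<dots> \<le> norm (g ?y - g ?x) + norm (g ?y - g ?x - \<bar>y - t\<bar> *\<^sub>R d)"
          using norm_triangle_sub norm_minus_commute by metis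
        finally have "f ?y - f ?x \<le> norm (g ?y - g ?x) + e * \<bar>y - t\<bar>"
          using elim(3) by (simp add: algebra_simps)
        then show ?case
          unfolding P_def yx using \<open>?x < ?y\<close>
          by (intro exI[of _ 1] exI[of _ "\<lambda>i. if i = 0 then ?x else ?y"])
            (simp add: subdivision_def dist_norm norm_minus_commute)
      qed
    qed
  next
    case False
    with \<open>a \<le> b\<close> show ?thesis
      \<comment> \<open>A one-point interval is subdivided into no pieces at all.\<close>
      unfolding P_def by (intro exI[of _ 0] exI[of _ "\<lambda>_. a"]) (simp add: subdivision_def)
  qed
  then show ?thesis using that unfolding P_def by blast
qed

lemma polygonal_length_le_curve_length:
  assumes "rectifiable g" "subdivision 0 1 m s"
  shows "(\<Sum>i<m. dist (g (s i)) (g (s (Suc i)))) \<le> curve_length g"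
  unfolding curve_length_def
  using assms by (intro cSup_upper) (auto simp: polygonal_lengths_def rectifiable_def)

lemma subdivision_mono:
  assumes "subdivision a b m s" "i \<le> j" "j \<le> m"
  shows "s i \<le> s j"
  using assms(2,3)
proof (induction j rule: dec_induct)
  case (step k)
  then show ?case using assms(1) unfolding subdivision_def by (smt (verit) Suc_le_lessD Suc_leD)
qed simp

text \<open>Telescoping along any subdivision bounds every inscribed polygon. This is how lengths of
  competitors are bounded from above.\<close>

lemma curve_length_le_potential_difference:
  assumes "\<And>x y. 0 \<le> x \<Longrightarrow> x < y \<Longrightarrow> y \<le> 1 \<Longrightarrow> dist (g x) (g y) \<le> \<phi> y - \<phi> x"
  shows "rectifiable g" "curve_length g \<le> \<phi> 1 - \<phi> 0"
proof -
  have *: "p \<le> \<phi> 1 - \<phi> 0" if "p \<in> polygonal_lengths g" for p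
  proof -
    from that obtain m s where s: "subdivision 0 1 m s"
      and p: "p = (\<Sum>i<m. dist (g (s i)) (g (s (Suc i))))"
      unfolding polygonal_lengths_def by blast
    have s01: "s 0 = 0" "s m = 1" using s by (auto simp: subdivision_def)
    have "p \<le> (\<Sum>i<m. \<phi> (s (Suc i)) - \<phi> (s i))"
      unfolding p
    proof (intro sum_mono assms)
      fix i assume "i \<in> {..<m}"
      then show "0 \<le> s i" "s i < s (Suc i)" "s (Suc i) \<le> 1"
        using s subdivision_mono[OF s, of 0 i] subdivision_mono[OF s, of "Suc i" m] s01
        by (auto simp: subdivision_def)
    qed
    also have "\<dots> = \<phi> 1 - \<phi> 0" using sum_lessThan_telescope[of "\<lambda>i. \<phi> (s i)" m] s01 by simp
    finally show ?thesis .
  qed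
  then show "rectifiable g" unfolding rectifiable_def bdd_above_def by blast
  have "polygonal_lengths g \<noteq> {}"
    unfolding polygonal_lengths_def using subdivision_single[of 0 1] by auto
  then show "curve_length g \<le> \<phi> 1 - \<phi> 0" unfolding curve_length_def by (intro cSup_least *)
qed

text \<open>A curve at most as long as the increase of its calibrating potential \<open>f\<close> attains equality in
  the calibration inequality on every subinterval, because excess length there could not be made up elsewhere.\<close>

lemma dist_le_potential_difference:
  fixes f :: "real \<Rightarrow> real"
  assumes "rectifiable g" "curve_length g \<le> f 1 - f 0"
    and der: "\<And>t S. side 0 1 t S \<Longrightarrow> \<exists>D d. (f has_vector_derivative D) (at t within S) \<and>
      (g has_vector_derivative d) (at t within S) \<and> D \<le> norm d"
    and xy: "0 \<le> x" "x < y" "y \<le> 1"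
  shows "dist (g x) (g y) \<le> f y - f x"
proof (rule field_le_epsilon)
  fix e :: real assume "e > 0"
  have sub: "\<exists>D d. (f has_vector_derivative D) (at t within S) \<and>
      (g has_vector_derivative d) (at t within S) \<and> D \<le> norm d"
    if "side a b t S" "0 \<le> a" "b \<le> 1" for a b t S
  proof -
    from side_subinterval[OF that] obtain S' where "side 0 1 t S'" "S \<subseteq> S'" .
    with der[of t S'] show ?thesis by (meson has_vector_derivative_within_subset)
  qed
  \<comment> \<open>Outside \<open>x\<close> and \<open>y\<close> the curve is replaced by polygons
    that nearly account for the increase of \<open>f\<close>, and between them by the single chord.
    The joined polygon is no longer than the curve, so the chord gets only what \<open>f\<close>
    leaves over.\<close>
  obtain m s where 1: "subdivision 0 x m s"
    "f x - f 0 \<le> (\<Sum>i<m. dist (g (s i)) (g (s (Suc i)))) + e * (x - 0)"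
    by (rule exists_inscribed_polygon[OF xy(1) \<open>e > 0\<close>, of f g]) (use sub xy in auto)
  obtain n u where 2: "subdivision y 1 n u"
    "f 1 - f y \<le> (\<Sum>i<n. dist (g (u i)) (g (u (Suc i)))) + e * (1 - y)"
    by (rule exists_inscribed_polygon[OF xy(3) \<open>e > 0\<close>, of f g]) (use sub xy in auto)
  obtain v where 3: "subdivision 0 y (m + 1) v"
    "(\<Sum>i<m + 1. dist (g (v i)) (g (v (Suc i)))) = (\<Sum>i<m. dist (g (s i)) (g (s (Suc i)))) + dist (g x) (g y)"
    using subdivision_append[OF 1(1) subdivision_single[OF xy(2)], of g] by auto
  obtain z where 4: "subdivision 0 1 (m + 1 + n) z"
    "(\<Sum>i<m + 1 + n. dist (g (z i)) (g (z (Suc i)))) =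
       (\<Sum>i<m. dist (g (s i)) (g (s (Suc i)))) + dist (g x) (g y) + (\<Sum>i<n. dist (g (u i)) (g (u (Suc i))))"
    using subdivision_append[OF 3(1) 2(1), of g] 3(2) by auto
  have "(\<Sum>i<m + 1 + n. dist (g (z i)) (g (z (Suc i)))) \<le> f 1 - f 0"
    using polygonal_length_le_curve_length[OF assms(1) 4(1)] assms(2) by linarith
  then have "dist (g x) (g y) \<le> f y - f x + e * (x + (1 - y))"
    unfolding 4(2) using 1(2) 2(2) by (simp add: algebra_simps)
  also have "e * (x + (1 - y)) \<le> e * 1" using xy \<open>e > 0\<close> by (intro mult_left_mono) auto
  finally show "dist (g x) (g y) \<le> f y - f x + e" by simp
qed

text \<open>Difference quotients turn a bound on chords into one on one-sided tangents. It yields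
  the converse of the calibration inequality along a shortest curve.\<close>

lemma norm_derivative_le_if_dist_le:
  fixes f :: "real \<Rightarrow> real"
  assumes S: "side a b t S"
    and f: "(f has_vector_derivative D) (at t within S)"
    and g: "(g has_vector_derivative d) (at t within S)"
    and le: "\<And>x y. a \<le> x \<Longrightarrow> x < y \<Longrightarrow> y \<le> b \<Longrightarrow> norm (g y - g x) \<le> f y - f x"
  shows "norm d \<le> D"
proof (rule field_le_epsilon)
  fix e :: real assume "e > 0"
  then have e: "e / 2 > 0" by simp
  have "\<forall>\<^sub>F y in at t within S. y \<in> S" by (simp add: eventually_at_filter)
  with eventually_at_neq eventually_increment[OF f e] eventually_increment[OF g e]
  have "\<forall>\<^sub>F y in at t within S. norm d \<le> D + e"
  proof eventually_elim
    case (elim y)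
    let ?x = "min t y" and ?y = "max t y"
    have "y \<in> {a..b}" "t \<in> {a..b}" using elim(4) side_subset[OF S] side_mem[OF S] by auto
    then have "norm (g ?y - g ?x) \<le> f ?y - f ?x" using elim(1) by (intro le) auto
    also have "\<dots> \<le> \<bar>y - t\<bar> * D + e / 2 * \<bar>y - t\<bar>"
      using elim(2) unfolding real_norm_def real_scaleR_def abs_le_iff by argo
    finally have "norm (\<bar>y - t\<bar> *\<^sub>R d) \<le> \<bar>y - t\<bar> * D + e / 2 * \<bar>y - t\<bar> + e / 2 * \<bar>y - t\<bar>"
      using elim(3) norm_triangle_sub[of "\<bar>y - t\<bar> *\<^sub>R d" "g ?y - g ?x"]
      by (simp add: norm_minus_commute)
    then have "\<bar>y - t\<bar> * norm d \<le> \<bar>y - t\<bar> * (D + e)" by (simp add: algebra_simps)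
    then show ?case using elim(1) by simp
  qed
  then show "norm d \<le> D + e"
    using side_nontrivial[OF S] eventually_happens' by blast
qed

section \<open>Angle-restricted curves in logarithmic polar coordinates\<close>

text \<open>Induction on the number of pieces. A one-sided limit at \<open>t\<close> sees only one
  piece next to \<open>t\<close>, and moving the far end of the side does not change the
  limit.\<close>

lemma piecewise_smooth_between_imp_side_derivative:
  assumes "piecewise_smooth_between g a b" "side a b t S"
  obtains d where "d \<noteq> 0" "(g has_vector_derivative d) (at t within S)"
proof -
  have "\<exists>d. d \<noteq> 0 \<and> (g has_vector_derivative d) (at t within S)"
    if "subdivision a b m s" "\<forall>i<m. smooth_between g (s i) (s (Suc i))" "side a b t S" for m s b S
    using that
  proof (induction m arbitrary: b S)
    case 0
    then show ?case by (auto simp: subdivision_def side_def)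
  next
    case (Suc m)
    define c where "c = s m"
    have sub: "subdivision a c m s" and cb: "c < b" "b = s (Suc m)"
      using Suc.prems(1) by (auto simp: subdivision_def c_def)
    have ac: "a \<le> c" using subdivision_mono[OF sub, of 0 m] sub by (simp add: subdivision_def)
    \<comment> \<open>At the breakpoint \<open>c\<close> itself the left side belongs to the earlier
      pieces and the right side to the last piece.\<close>
    consider (init) S' where "side a c t S'" "at t within S = at t within S'"
      | (last) S' where "side c b t S'" "at t within S = at t within S'"
    proof (cases "t < c \<or> t = c \<and> S = {a..t} \<and> a < t")
      case True
      then have "side a c t (if S = {t..b} then {t..c} else S)"
        "at t within S = at t within (if S = {t..b} then {t..c} else S)"
        using Suc.prems(3) cb by (auto simp: side_def at_within_Icc_at_right)
      then show ?thesis by (rule init)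
    next
      case False
      then have "side c b t (if S = {t..b} \<and> t < b then S else {c..t})"
        "at t within S = at t within (if S = {t..b} \<and> t < b then S else {c..t})"
        using Suc.prems(3) cb ac by (auto simp: side_def at_within_Icc_at_left)
      then show ?thesis by (rule last)
    qed
    then show ?case
    proof cases
      case init
      then show ?thesis using Suc.IH[OF sub _ init(1)] Suc.prems(2) by simp
    next
      case last
      from Suc.prems(2) cb obtain g' where
        g': "\<And>u. u \<in> {c..b} \<Longrightarrow> g' u \<noteq> 0 \<and> (g has_vector_derivative g' u) (at u within {c..b})"
        unfolding smooth_between_def c_def by blast
      have "t \<in> {c..b}" "S' \<subseteq> {c..b}" using last(1) side_mem side_subset by blast+
      then show ?thesis
        unfolding last(2) using g' has_vector_derivative_within_subset by blast
    qed
  qed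
  with assms that show ?thesis unfolding piecewise_smooth_between_def by blast
qed

text \<open>Applying the decreasing cosine to the bound on \<open>arccos\<close> and clearing
  denominators gives a form without quotients, which is trivially true for
  \<open>d = 0\<close>.\<close>

lemma angle_restricted_imp_inner_ge:
  assumes "angle_restricted \<alpha> r g" "0 \<le> \<alpha>" "\<alpha> \<le> pi" "side 0 1 t S"
    "(g has_vector_derivative d) (at t within S)" "g t \<noteq> r"
  shows "cos \<alpha> * (norm d * norm (r - g t)) \<le> d \<bullet> (r - g t)"
proof (cases "d = 0")
  case False
  define n where "n = norm d * norm (r - g t)"
  have "n > 0" using False assms(6) by (simp add: n_def)
  define y where "y = (d \<bullet> (r - g t)) / n"
  have y: "\<bar>y\<bar> \<le> 1" using \<open>n > 0\<close> Cauchy_Schwarz_ineq2[of d "r - g t"]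
    by (simp add: y_def n_def[symmetric])
  have "one_sided_tangent g t d"
    using assms(4,5) unfolding one_sided_tangent_def side_def by auto
  then have "arccos y \<le> \<alpha>"
    using assms(1,6) side_mem[OF assms(4)] unfolding angle_restricted_def angle_between_def y_def n_def
    by blast
  then have "cos \<alpha> \<le> cos (arccos y)"
    using y assms(2,3) by (intro cos_monotone_0_pi_le) (auto simp: arccos_lbound)
  then have "cos \<alpha> \<le> y" using y by simp
  then show ?thesis using \<open>n > 0\<close> by (simp add: y_def n_def[symmetric] field_simps)
qed simp

text \<open>The distance to the root decreases along an angle-restricted curve wherever it is positive, so
  a curve that reaches the root cannot leave it.\<close>

lemma angle_restricted_avoids_root:
  assumes "path g" "piecewise_smooth_away_from r g" "angle_restricted \<alpha> r g"
    and \<alpha>: "0 \<le> \<alpha>" "\<alpha> \<le> pi / 2" and "g 1 \<noteq> r" "t \<in> {0..1}"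
  shows "g t \<noteq> r"
proof
  assume "g t = r"
  have cont: "continuous_on {0..1} g" using assms(1) by (simp add: path_def)
  have mono: "norm (g 1 - r) \<le> norm (g a - r)" if a: "0 \<le> a" "a < 1" "r \<notin> g ` {a..1}" for a
  proof -
    have "(norm (g 1 - r))\<^sup>2 \<le> (norm (g a - r))\<^sup>2"
      unfolding power2_norm_eq_inner
    proof (rule decreasing_if_side_derivatives_nonpos[of a 1 "\<lambda>u. (g u - r) \<bullet> (g u - r)"])
      fix u S assume S: "side a 1 u S"
      have "piecewise_smooth_between g a 1"
        using assms(2) a unfolding piecewise_smooth_away_from_def by simp
      from piecewise_smooth_between_imp_side_derivative[OF this S]
      obtain d where d: "(g has_vector_derivative d) (at u within S)" by blast
      obtain S' where S': "side 0 1 u S'" "S \<subseteq> S'"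
        using side_subinterval[OF S a(1) order_refl] by blast
      \<comment> \<open>The two sides differ at most in how far they reach to the left, so a
        derivative on the smaller one is a derivative on the larger one.\<close>
      have "at u within S = at u within S'"
        using S S' a(1) by (auto simp: side_def at_within_Icc_at_left)
      with d have d': "(g has_vector_derivative d) (at u within S')" by simp
      have "g u \<noteq> r" using a(3) side_mem[OF S] by auto
      from angle_restricted_imp_inner_ge[OF assms(3) _ _ S'(1) d' this] \<alpha>
      have "cos \<alpha> * (norm d * norm (r - g u)) \<le> d \<bullet> (r - g u)" by simp
      moreover have "0 \<le> cos \<alpha> * (norm d * norm (r - g u))" using \<alpha> by (simp add: cos_ge_zero)
      ultimately have le: "d \<bullet> (g u - r) \<le> 0" by (simp add: inner_diff_right)
      have "((\<lambda>u. (g u - r) \<bullet> (g u - r)) has_vector_derivative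
          ((g u - r) \<bullet> (d - 0) + (d - 0) \<bullet> (g u - r))) (at u within S)"
        by (intro bounded_bilinear.has_vector_derivative[OF bounded_bilinear_inner]
            has_vector_derivative_diff d has_vector_derivative_const)
      with le show "\<exists>D\<le>0. ((\<lambda>u. (g u - r) \<bullet> (g u - r)) has_vector_derivative D) (at u within S)"
        by (intro exI[of _ "(g u - r) \<bullet> (d - 0) + (d - 0) \<bullet> (g u - r)"])
          (simp add: inner_commute)
    qed (use a in auto)
    then show ?thesis by simp
  qed
  \<comment> \<open>The last visit \<open>z\<close> to the root is compared with a moment
    \<open>u\<close> shortly after it, when the curve is still closer to \<open>r\<close> than its
    end is. From \<open>u\<close> on the root is avoided and the distance cannot grow, a
    contradiction.\<close>
  define Z where "Z = {u \<in> {0..1}. g u = r}"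
  have "closed Z"
    unfolding Z_def using continuous_closed_preimage_constant[OF cont closed_atLeastAtMost, of r]
    by simp
  moreover have "bounded Z" by (rule bounded_subset[of "{0..1}"]) (auto simp: Z_def)
  ultimately have "compact Z" by (simp add: compact_eq_bounded_closed)
  moreover have "Z \<noteq> {}" using \<open>g t = r\<close> assms(7) by (auto simp: Z_def)
  ultimately obtain z where z: "z \<in> Z" "\<And>u. u \<in> Z \<Longrightarrow> u \<le> z"
    using compact_attains_sup[of Z] by metis
  have z01: "0 \<le> z" "z < 1" "g z = r"
    using z(1) assms(6) unfolding Z_def by (auto simp: less_le)
  have "norm (g 1 - r) > 0" using assms(6) by simp
  with cont z01 obtain e where e: "e > 0"
    "\<And>u. u \<in> {0..1} \<Longrightarrow> dist u z < e \<Longrightarrow> dist (g u) (g z) < norm (g 1 - r)"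
    unfolding continuous_on_iff by (metis atLeastAtMost_iff less_le)
  define u where "u = min (z + e / 2) ((z + 1) / 2)"
  have u: "z < u" "u < 1" "u - z < e" using e(1) z01 by (auto simp: u_def min_def)
  have "r \<notin> g ` {u..1}"
  proof
    assume "r \<in> g ` {u..1}"
    then obtain v where "v \<in> {u..1}" "g v = r" by auto
    then show False using z(2)[of v] u z01 by (auto simp: Z_def)
  qed
  from mono[OF _ u(2) this] u z01 e(2)[of u] show False by (simp add: dist_norm)
qed

text \<open>Near \<open>t\<close>, continuity keeps \<open>q u - q t\<close> inside the strip where
  \<open>Ln\<close> inverts \<open>exp\<close>. There \<open>q u\<close> equals
  \<open>q t + Ln (z u / z t)\<close>, and the principal branch is differentiated at 1 only, away
  from its cut.\<close>

lemma has_vector_derivative_logarithm: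
  fixes q z :: "real \<Rightarrow> complex"
  assumes "continuous_on A q" "\<And>u. u \<in> A \<Longrightarrow> z u = exp (q u)" "t \<in> S" "S \<subseteq> A"
    "(z has_vector_derivative d) (at t within S)"
  shows "(q has_vector_derivative d / z t) (at t within S)"
proof -
  have "t \<in> A" using assms by auto
  with assms(1) pi_gt_zero obtain e where e: "e > 0"
    "\<And>u. u \<in> A \<Longrightarrow> dist u t < e \<Longrightarrow> dist (q u) (q t) < pi"
    unfolding continuous_on_iff by blast
  have nz: "z t \<noteq> 0" using assms(2)[OF \<open>t \<in> A\<close>] by simp
  have *: "q t + Ln (z u / z t) = q u" if "u \<in> S" "dist u t < e" for u
  proof -
    have "u \<in> A" using that assms by auto
    have "\<bar>Im (q u - q t)\<bar> < pi"
      using e(2)[OF \<open>u \<in> A\<close> that(2)] abs_Im_le_cmod[of "q u - q t"] by (simp add: dist_norm)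
    then have "Ln (exp (q u - q t)) = q u - q t" by (intro Ln_exp) auto
    then show ?thesis using assms(2)[OF \<open>u \<in> A\<close>] assms(2)[OF \<open>t \<in> A\<close>] by (simp add: exp_diff)
  qed
  have "((\<lambda>u. z u / z t) has_vector_derivative d / z t) (at t within S)"
    using assms(5) by (rule has_vector_derivative_divide)
  moreover have "(Ln has_field_derivative 1) (at (z t / z t) within (\<lambda>u. z u / z t) ` S)"
    using nz by (auto intro!: derivative_eq_intros)
  ultimately have "((Ln \<circ> (\<lambda>u. z u / z t)) has_vector_derivative (d / z t * 1)) (at t within S)"
    by (rule field_vector_diff_chain_within)
  then have "((\<lambda>u. q t + Ln (z u / z t)) has_vector_derivative d / z t) (at t within S)"
    by (auto simp: o_def intro!: derivative_eq_intros)
  then show ?thesis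
    by (rule has_vector_derivative_transform_within[OF _ e(1) assms(3)]) (use * in auto)
qed

text \<open>A continuous \<open>h\<close> maps the interval onto an interval, whether or not it is
  monotone, and an affine map takes that to a closed segment. Distinct end values exclude a single
  point.\<close>

lemma line_segment_image:
  fixes h :: "real \<Rightarrow> real"
  assumes "a \<le> b" "continuous_on {a..b} h" "\<And>t. t \<in> {a..b} \<Longrightarrow> g t = A + of_real (h t) * B"
    and "g a \<noteq> g b"
  shows "line_segment (g ` {a..b})"
proof -
  obtain l u where lu: "h ` {a..b} = {l..u}" "l \<le> u"
    using continuous_image_closed_interval[OF assms(1,2)] by blast
  define F where "F x = A + of_real x * B" for x
  have img: "g ` {a..b} = F ` {l..u}"
    unfolding lu(1)[symmetric] image_image F_def using assms(3) by auto
  have "F ` {l..u} = closed_segment (F l) (F u)"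
  proof -
    have "{l..u} = closed_segment l u" using lu(2) by (simp add: closed_segment_eq_real_ivl)
    moreover have "F ` closed_segment l u = (+) A ` (\<lambda>x. of_real x * B) ` closed_segment l u"
      by (simp add: F_def image_image)
    moreover have "linear (\<lambda>x. of_real x * B)"
      by (simp add: linear_iff algebra_simps scaleR_conv_of_real)
    ultimately show ?thesis
      by (simp add: closed_segment_linear_image[symmetric] closed_segment_translation[symmetric] F_def)
  qed
  moreover have "F l \<noteq> F u"
  proof
    assume "F l = F u"
    with calculation img have "g ` {a..b} = {F l}" by simp
    then have "g a = F l" "g b = F l" using assms(1) by auto
    with assms(4) show False by simp
  qed
  ultimately show ?thesis unfolding line_segment_def img by blast
qed

text \<open>In the logarithmic coordinate a spiral is a straight ray of slope
  \<open>- tan \<beta>\<close>.\<close>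

lemma spiral_eq: "spiral \<beta> r p t = r + (p - r) * exp (Complex (- t) (tan \<beta> * t))"
proof -
  have "(p - r) * exp (Complex (- t) (tan \<beta> * t)) =
      rcis (cmod (p - r)) (Arg (p - r)) * rcis (exp (- t)) (tan \<beta> * t)"
    by (simp only: rcis_cmod_Arg) (simp add: exp_eq_polar rcis_def)
  then show ?thesis by (simp add: spiral_def rcis_mult)
qed

text \<open>The loss \<open>h\<close> of logarithmic distance since time \<open>a\<close> is the
  parameter of the spiral based at \<open>g a\<close>. Since it increases, its image is exactly the
  interval from 0 to \<open>h b\<close>.\<close>

lemma spiral_segment_image:
  fixes q :: "real \<Rightarrow> complex"
  assumes "continuous_on {a..b} q" "a < b" "\<And>t. t \<in> {a..b} \<Longrightarrow> g t = r + exp (q t)"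
    and "\<And>t. t \<in> {a..b} \<Longrightarrow> Im (q t) - Im (q a) = - tan \<beta> * (Re (q t) - Re (q a))"
    and decr: "\<And>s t. a \<le> s \<Longrightarrow> s < t \<Longrightarrow> t \<le> b \<Longrightarrow> Re (q t) < Re (q s)"
    and "\<beta> \<in> {\<alpha>, - \<alpha>}"
  shows "spiral_segment \<alpha> r (g ` {a..b})"
proof -
  define h where "h t = Re (q a) - Re (q t)" for t
  have "continuous_on {a..b} h"
    unfolding h_def by (intro continuous_intros assms(1))
  then obtain l u where lu: "h ` {a..b} = {l..u}" "l \<le> u"
    using continuous_image_closed_interval[of a b h] assms(2) by (meson less_imp_le)
  have "h t \<in> {h a..h b}" if "t \<in> {a..b}" for t
  proof -
    have "Re (q t) \<le> Re (q a)" using decr[of a t] that by (cases "t = a") simp_all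
    moreover have "Re (q b) \<le> Re (q t)" using decr[of t b] that by (cases "t = b") simp_all
    ultimately show ?thesis by (simp add: h_def)
  qed
  then have "{l..u} \<subseteq> {h a..h b}" unfolding lu(1)[symmetric] by (rule image_subsetI)
  moreover have "h a \<in> {l..u}" "h b \<in> {l..u}"
    unfolding lu(1)[symmetric] using assms(2) by simp_all
  ultimately have "{l..u} = {h a..h b}" using lu(2) unfolding atLeastatMost_subset_iff by simp
  then have h: "h ` {a..b} = {0..h b}" unfolding lu(1) by (simp add: h_def)
  have "g t = spiral \<beta> r (g a) (h t)" if "t \<in> {a..b}" for t
  proof -
    have "q t = q a + Complex (- h t) (tan \<beta> * h t)"
      using assms(4)[OF that] by (simp add: complex_eq_iff h_def algebra_simps)
    then show ?thesis
      using assms(3)[OF that] assms(3)[of a] assms(2) by (simp add: spiral_eq exp_add)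
  qed
  then have "g ` {a..b} = spiral \<beta> r (g a) ` h ` {a..b}"
    unfolding image_image by (rule image_cong[OF refl])
  moreover have "g a \<noteq> r" using assms(2) assms(3)[of a] by simp
  moreover have "0 < h b" using decr[of a b] assms(2) by (simp add: h_def)
  ultimately show ?thesis
    unfolding spiral_segment_def h
    by (intro exI[of _ "g a"] exI[of _ \<beta>] exI[of _ 0] exI[of _ "h b"] conjI disjI1 assms(6) order_refl)
qed

section \<open>The calibration\<close>

text \<open>The argument \<open>x\<close> is the logarithm of the distance from the root.\<close>

definition sin_profile :: "real \<Rightarrow> real \<Rightarrow> real \<Rightarrow> real" where
  "sin_profile \<alpha> d x = min (sin \<alpha>) (d * exp (- x))"

definition cos_profile :: "real \<Rightarrow> real \<Rightarrow> real \<Rightarrow> real" where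
  "cos_profile \<alpha> d x = sqrt (1 - (sin_profile \<alpha> d x)\<^sup>2)"

text \<open>In the logarithmic coordinate this is the turn of the comparison curve per unit loss of
  logarithmic distance.\<close>

definition tan_profile :: "real \<Rightarrow> real \<Rightarrow> real \<Rightarrow> real" where
  "tan_profile \<alpha> d x = sin_profile \<alpha> d x / cos_profile \<alpha> d x"

locale profile =
  fixes \<alpha> d :: real
  assumes \<alpha>: "0 < \<alpha>" "\<alpha> < pi / 2" and d: "0 \<le> d"
begin

section \<open>Elementary bounds for the profile angle\<close>

lemma cos_pos: "0 < cos \<alpha>" using \<alpha> by (simp add: cos_gt_zero)
lemma sin_pos: "0 < sin \<alpha>" using \<alpha> by (simp add: sin_gt_zero)
lemma sin_less_one: "sin \<alpha> < 1"
  using cos_pos sin_pos sin_cos_squared_add[of \<alpha>]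
  by (smt (verit) power2_eq_square mult_le_cancel_left1 zero_less_power)

lemma sin_profile_bounds: "0 \<le> sin_profile \<alpha> d x" "sin_profile \<alpha> d x \<le> sin \<alpha>"
  using sin_pos d by (auto simp: sin_profile_def)

lemma cos_profile_ge: "cos \<alpha> \<le> cos_profile \<alpha> d x"
proof -
  have "(sin_profile \<alpha> d x)\<^sup>2 \<le> (sin \<alpha>)\<^sup>2" using sin_profile_bounds by (intro power_mono) auto
  then have "(cos \<alpha>)\<^sup>2 \<le> 1 - (sin_profile \<alpha> d x)\<^sup>2" by (simp add: cos_squared_eq)
  then show ?thesis unfolding cos_profile_def by (rule real_le_rsqrt)
qed

lemma cos_profile_pos: "0 < cos_profile \<alpha> d x" using cos_profile_ge[of x] cos_pos by linarith

lemma profile_squares: "(sin_profile \<alpha> d x)\<^sup>2 + (cos_profile \<alpha> d x)\<^sup>2 = 1"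
proof -
  have "0 < 1 - (sin_profile \<alpha> d x)\<^sup>2"
    using cos_profile_pos[of x] unfolding cos_profile_def by simp
  then show ?thesis unfolding cos_profile_def by simp
qed

lemma cos_profile_le_one: "cos_profile \<alpha> d x \<le> 1"
  unfolding cos_profile_def by simp

lemma tan_profile_eq: "tan_profile \<alpha> d x * cos_profile \<alpha> d x = sin_profile \<alpha> d x"
  using cos_profile_pos[of x] by (simp add: tan_profile_def)

lemma tan_profile_spiral:
  assumes "sin \<alpha> \<le> d * exp (- x)"
  shows "tan_profile \<alpha> d x = tan \<alpha>"
proof -
  have "sin_profile \<alpha> d x = sin \<alpha>" using assms by (simp add: sin_profile_def)
  then show ?thesis
    using cos_pos by (simp add: tan_profile_def cos_profile_def tan_def cos_squared_eq[symmetric])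
qed

lemma one_plus_tan_profile_squared: "1 + (tan_profile \<alpha> d x)\<^sup>2 = (1 / cos_profile \<alpha> d x)\<^sup>2"
  using cos_profile_pos[of x] profile_squares[of x]
  by (simp add: tan_profile_def field_simps)

text \<open>Cauchy-Schwarz bounds the length from below by the component along the profile direction; the
  remaining difference is nonnegative because either the distance \<open>exp x * sin\<close> of
  the tangent line from the root equals \<open>d\<close> (straight part), or the direction is extreme (spiral part).\<close>

lemma calibration:
  assumes "\<sigma>\<^sup>2 = 1" and D: "\<bar>Im D\<bar> \<le> - tan \<alpha> * Re D"
  shows calibration_le: "\<sigma> * d * Im D + (d * tan_profile \<alpha> d x - exp x / cos_profile \<alpha> d x) * Re D \<le> exp x * norm D"
    and calibration_eq: "exp x * norm D \<le> \<sigma> * d * Im D + (d * tan_profile \<alpha> d x - exp x / cos_profile \<alpha> d x) * Re D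
      \<Longrightarrow> Im D = - \<sigma> * tan_profile \<alpha> d x * Re D"
proof -
  define S C T where "S = sin_profile \<alpha> d x" "C = cos_profile \<alpha> d x" "T = tan_profile \<alpha> d x"
  note defs = this
  \<comment> \<open>\<open>a\<close> is the rate of approach to the root on the logarithmic scale,
    and \<open>b\<close> is the rate of turning counted in the direction chosen by
    \<open>\<sigma>\<close>.\<close>
  define a b where "a = - Re D" "b = \<sigma> * Im D"
  note ab = this
  have SC: "S\<^sup>2 + C\<^sup>2 = 1" and C: "C > 0" and S: "S \<ge> 0" and T: "T * C = S"
    unfolding defs using profile_squares cos_profile_pos sin_profile_bounds tan_profile_eq by auto
  have "\<bar>\<sigma>\<bar> = 1" using assms(1) by (auto simp: power2_eq_1_iff)
  then have "b \<le> \<bar>Im D\<bar>" unfolding ab by (metis abs_ge_self abs_mult mult_1)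
  with D have b: "b \<le> tan \<alpha> * a" by (simp add: ab)
  have Im: "Im D = \<sigma> * b" using assms(1) by (simp add: ab power2_eq_square mult.assoc[symmetric])
  have n2: "(norm D)\<^sup>2 = a\<^sup>2 + b\<^sup>2"
    using assms(1) by (simp add: cmod_power2 ab power_mult_distrib)
  \<comment> \<open>The vector \<open>(a, b)\<close> is decomposed into its components along and
    across the unit vector \<open>(C, S)\<close>.\<close>
  have ident: "(norm D)\<^sup>2 = (C * a + S * b)\<^sup>2 + (S * a - C * b)\<^sup>2"
  proof -
    have "(C * a + S * b)\<^sup>2 + (S * a - C * b)\<^sup>2 = (S\<^sup>2 + C\<^sup>2) * (a\<^sup>2 + b\<^sup>2)"
      by (simp add: power2_eq_square algebra_simps)
    with SC n2 show ?thesis by simp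
  qed
  then have "(C * a + S * b)\<^sup>2 \<le> (norm D)\<^sup>2" by simp
  then have CS: "C * a + S * b \<le> norm D" by (rule power2_le_imp_le) simp
  \<comment> \<open>On the straight part the two factors coincide. On the spiral part
    \<open>exp x * S \<le> d\<close>, and \<open>b - T * a\<close> is nonpositive by the angle
    restriction.\<close>
  have key: "d * (b - T * a) \<le> exp x * S * (b - T * a)"
  proof (cases "d * exp (- x) \<le> sin \<alpha>")
    case True
    then have "exp x * S = d" by (simp add: defs sin_profile_def exp_minus)
    then show ?thesis by simp
  next
    case False
    then have "T = tan \<alpha>" and "S = sin \<alpha>" unfolding defs
      using tan_profile_spiral by (auto simp: sin_profile_def)
    moreover have "exp x * sin \<alpha> \<le> d"
      using False by (simp add: exp_minus field_simps)
    ultimately show ?thesis using b by (intro mult_right_mono_neg) auto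
  qed
  have lhs: "\<sigma> * d * Im D + (d * T - exp x / C) * Re D = d * (b - T * a) + exp x * a / C"
    using assms(1) unfolding Im by (simp add: ab(1) algebra_simps power2_eq_square)
  have aC: "a / C = C * a + S * (T * a)"
  proof -
    have "C * a + S * (T * a) = (C * C + S * (T * C)) * a / C" using C by (simp add: field_simps)
    also have "C * C + S * (T * C) = 1" unfolding T using SC by (simp add: power2_eq_square)
    finally show ?thesis by simp
  qed
  have "exp x * a / C = exp x * (C * a + S * (T * a))" unfolding aC[symmetric] by simp
  then have le: "d * (b - T * a) + exp x * a / C \<le> exp x * (C * a + S * b)"
    using key by (simp add: algebra_simps)
  also have "\<dots> \<le> exp x * norm D" using CS by simp
  finally show "\<sigma> * d * Im D + (d * tan_profile \<alpha> d x - exp x / cos_profile \<alpha> d x) * Re D \<le> exp x * norm D"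
    using lhs unfolding defs by simp
  assume "exp x * norm D \<le> \<sigma> * d * Im D + (d * tan_profile \<alpha> d x - exp x / cos_profile \<alpha> d x) * Re D"
  then have "exp x * norm D \<le> exp x * (C * a + S * b)" using lhs le unfolding defs by linarith
  then have "norm D = C * a + S * b" using CS by simp
  \<comment> \<open>Equality in Cauchy-Schwarz makes the transverse component vanish, which fixes
    the slope.\<close>
  with ident have "S * a = C * b" by simp
  then have "b * C = T * a * C" using T by (metis mult.assoc mult.commute)
  with C have "b = T * a" by simp
  then show "Im D = - \<sigma> * tan_profile \<alpha> d x * Re D" unfolding Im by (simp add: ab(1) defs)
qed

lemma continuous_profile:
  shows "continuous_on A (sin_profile \<alpha> d)" "continuous_on A (cos_profile \<alpha> d)"
    "continuous_on A (tan_profile \<alpha> d)"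
proof -
  show S: "continuous_on A (sin_profile \<alpha> d)"
    unfolding sin_profile_def by (intro continuous_intros)
  then show C: "continuous_on A (cos_profile \<alpha> d)"
    unfolding cos_profile_def by (intro continuous_intros)
  show "continuous_on A (tan_profile \<alpha> d)"
    unfolding tan_profile_def using cos_profile_pos
    by (intro continuous_intros S C) (metis less_irrefl)
qed

end

lemma exists_profile:
  assumes \<alpha>: "0 < \<alpha>" "\<alpha> < pi / 2" and "a \<le> b" "0 \<le> \<Delta>" "\<Delta> \<le> tan \<alpha> * (b - a)"
  obtains d where "0 \<le> d" "integral {a..b} (tan_profile \<alpha> d) = \<Delta>"
proof -
  define I where "I d = integral (cbox a b) (tan_profile \<alpha> d)" for d
  have pr: "profile \<alpha> d" if "0 \<le> d" for d using \<alpha> that by unfold_locales auto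
  have "continuous_on {0..exp b} I"
    unfolding I_def
  proof (rule integral_continuous_on_param)
    have S: "continuous_on ({0..exp b} \<times> cbox a b) (\<lambda>p. sin_profile \<alpha> (fst p) (snd p))"
      unfolding sin_profile_def by (intro continuous_intros)
    have C: "continuous_on ({0..exp b} \<times> cbox a b) (\<lambda>p. cos_profile \<alpha> (fst p) (snd p))"
      unfolding cos_profile_def by (intro continuous_intros S)
    show "continuous_on ({0..exp b} \<times> cbox a b) (\<lambda>(d, x). tan_profile \<alpha> d x)"
      unfolding tan_profile_def case_prod_unfold
      using profile.cos_profile_pos[OF pr]
      by (intro continuous_intros S C) (metis atLeastAtMost_iff less_irrefl mem_Times_iff)
  qed
  moreover have "I 0 \<le> \<Delta>"
  proof -
    have "tan_profile \<alpha> 0 = (\<lambda>x. 0)"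
      using \<alpha> sin_gt_zero[of \<alpha>] by (auto simp: tan_profile_def sin_profile_def fun_eq_iff)
    then show ?thesis using assms(4) by (simp add: I_def)
  qed
  moreover have "\<Delta> \<le> I (exp b)"
  proof -
    have "tan_profile \<alpha> (exp b) x = tan \<alpha>" if "x \<in> cbox a b" for x
    proof (rule profile.tan_profile_spiral[OF pr])
      have "sin \<alpha> \<le> 1" by simp
      also have "1 \<le> exp b * exp (- x)" using that by (simp add: exp_add[symmetric])
      finally show "sin \<alpha> \<le> exp b * exp (- x)" .
    qed simp
    then have "I (exp b) = integral (cbox a b) (\<lambda>x. tan \<alpha>)"
      unfolding I_def by (intro integral_cong) auto
    then show ?thesis using assms(3,5) by (simp add: mult.commute)
  qed
  ultimately obtain d where "0 \<le> d" "I d = \<Delta>"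
    using IVT'[of I 0 \<Delta> "exp b"] by auto
  with that show ?thesis by (simp add: I_def)
qed

section \<open>The comparison curve\<close>

lemma has_vector_derivative_exp_curve:
  assumes "(q has_vector_derivative D) (at t within S)"
  shows "((\<lambda>t. r + exp (q t :: complex)) has_vector_derivative exp (q t) * D) (at t within S)"
proof -
  have "((exp \<circ> q) has_vector_derivative (D * exp (q t))) (at t within S)"
    using assms by (rule field_vector_diff_chain_within) (auto intro!: derivative_eq_intros)
  then show ?thesis
    by (auto simp: o_def mult.commute intro!: derivative_eq_intros)
qed

lemma inner_mult_self_complex: "(E * D) \<bullet> E = (norm E)\<^sup>2 * Re D" for E D :: complex
  unfolding cmod_power2 by (simp add: inner_complex_def power2_eq_square algebra_simps)

context profile
begin

text \<open>The logarithmic distance runs linearly from \<open>x0\<close> to \<open>x1\<close> while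
  the polar angle follows \<open>\<sigma> * K\<close>, so the slope is the profile slope. With
  antiderivatives \<open>K\<close> and \<open>H\<close>, the end point and the length bound are
  expressed by differences at \<open>x0\<close> and \<open>x1\<close>.\<close>

lemma comparison_curve:
  assumes \<sigma>: "\<sigma>\<^sup>2 = 1" and x: "x1 < x0"
    and K: "\<And>x. x \<in> {x1..x0} \<Longrightarrow> (K has_real_derivative - tan_profile \<alpha> d x) (at x)"
    and H: "\<And>x. x \<in> {x1..x0} \<Longrightarrow>
      (H has_real_derivative d * tan_profile \<alpha> d x - exp x / cos_profile \<alpha> d x) (at x)"
  obtains \<gamma> where "path \<gamma>" "pathstart \<gamma> = r + exp (Complex x0 y0)"
    "pathfinish \<gamma> = r + exp (Complex x1 (y0 + \<sigma> * (K x1 - K x0)))"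
    "rectifiable \<gamma>" "piecewise_smooth_away_from r \<gamma>" "angle_restricted \<alpha> r \<gamma>"
    "curve_length \<gamma> \<le> d * (K x1 - K x0) + (H x1 - H x0)"
proof -
  define X where "X = x0 - x1"
  have X: "X > 0" using x by (simp add: X_def)
  define p where "p t = x0 - t * X" for t
  have p: "p t \<in> {x1..x0}" if "t \<in> {0..1}" for t
  proof -
    have "0 \<le> t * X" "t * X \<le> 1 * X" using that X by (auto intro: mult_right_mono)
    then show ?thesis by (simp add: p_def X_def)
  qed
  define Q where "Q t = Complex (p t) (y0 + \<sigma> * (K (p t) - K x0))" for t
  define Q' where "Q' t = Complex (- X) (\<sigma> * tan_profile \<alpha> d (p t) * X)" for t
  define \<gamma> where "\<gamma> t = r + exp (Q t)" for t
  define \<gamma>' where "\<gamma>' t = exp (Q t) * Q' t" for t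
  \<comment> \<open>The calibrating potential along the curve. In its derivative the terms with
    \<open>d\<close> cancel and exactly the speed \<open>norm (\<gamma>' t)\<close> remains.\<close>
  define \<phi> where "\<phi> t = d * (K (p t) - K x0) + H (p t)" for t
  have dp: "(p has_real_derivative - X) (at t)" for t
    unfolding p_def by (auto intro!: derivative_eq_intros)
  have dK: "((\<lambda>t. K (p t)) has_real_derivative - tan_profile \<alpha> d (p t) * - X) (at t)" if "t \<in> {0..1}" for t
    by (rule DERIV_chain2[OF K[OF p[OF that]] dp])
  have dH: "((\<lambda>t. H (p t)) has_real_derivative (d * tan_profile \<alpha> d (p t) - exp (p t) / cos_profile \<alpha> d (p t)) * - X) (at t)"
    if "t \<in> {0..1}" for t
    by (rule DERIV_chain2[OF H[OF p[OF that]] dp])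
  have dQ: "(Q has_vector_derivative Q' t) (at t)" if "t \<in> {0..1}" for t
    unfolding has_vector_derivative_complex_iff Q_def Q'_def complex.sel
    using dp[of t] dK[OF that] by (auto intro!: derivative_eq_intros)
  have d\<gamma>: "(\<gamma> has_vector_derivative \<gamma>' t) (at t)" if "t \<in> {0..1}" for t
    unfolding \<gamma>_def[abs_def] \<gamma>'_def by (rule has_vector_derivative_exp_curve[OF dQ[OF that]])
  have d\<phi>: "(\<phi> has_vector_derivative X * exp (p t) / cos_profile \<alpha> d (p t)) (at t)" if "t \<in> {0..1}" for t
    unfolding has_real_derivative_iff_has_vector_derivative[symmetric] \<phi>_def[abs_def]
    using dK[OF that] dH[OF that] by (auto intro!: derivative_eq_intros simp: algebra_simps)
  have nQ': "norm (Q' t) = X / cos_profile \<alpha> d (p t)" for t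
  proof -
    have "(norm (Q' t))\<^sup>2 = X\<^sup>2 * (1 + \<sigma>\<^sup>2 * (tan_profile \<alpha> d (p t))\<^sup>2)"
      unfolding cmod_power2 Q'_def by (simp add: power_mult_distrib algebra_simps)
    also have "\<dots> = (X / cos_profile \<alpha> d (p t))\<^sup>2"
      unfolding \<sigma> using one_plus_tan_profile_squared[of "p t"] by (simp add: power_divide)
    finally show ?thesis
      by (rule power2_eq_imp_eq) (use X cos_profile_pos[of "p t"] in simp_all)
  qed
  have n\<gamma>': "norm (\<gamma>' t) = X * exp (p t) / cos_profile \<alpha> d (p t)" for t
    by (simp add: \<gamma>'_def norm_mult nQ' Q_def)
  have cont: "continuous_on {0..1} \<gamma>"
    by (rule continuous_on_vector_derivative) (rule has_vector_derivative_at_within[OF d\<gamma>])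
  have contQ: "continuous_on {0..1} Q"
    by (rule continuous_on_vector_derivative) (rule has_vector_derivative_at_within[OF dQ])
  have cont': "continuous_on {0..1} \<gamma>'"
    unfolding \<gamma>'_def[abs_def] Q'_def p_def
    by (intro continuous_intros contQ continuous_on_compose2[OF continuous_profile(3)[of UNIV]]) auto
  have \<phi>dist: "dist (\<gamma> s) (\<gamma> t) \<le> \<phi> t - \<phi> s" if st: "0 \<le> s" "s < t" "t \<le> 1" for s t
  proof -
    have "norm (\<gamma> t - \<gamma> s) \<le> \<phi> t - \<phi> s"
    proof (rule differentiable_bound_general[OF st(2)])
      show "continuous_on {s..t} \<gamma>" using cont st by (auto elim: continuous_on_subset)
      show "continuous_on {s..t} \<phi>"
        by (rule continuous_on_vector_derivative, rule has_vector_derivative_at_within[OF d\<phi>])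
          (use st in auto)
      fix u assume "s < u" "u < t"
      then have u: "u \<in> {0..1}" using st by auto
      show "(\<gamma> has_vector_derivative \<gamma>' u) (at u)" by (rule d\<gamma>[OF u])
      show "(\<phi> has_vector_derivative X * exp (p u) / cos_profile \<alpha> d (p u)) (at u)" by (rule d\<phi>[OF u])
      show "norm (\<gamma>' u) \<le> X * exp (p u) / cos_profile \<alpha> d (p u)" by (simp add: n\<gamma>')
    qed
    then show ?thesis by (simp add: dist_norm norm_minus_commute)
  qed
  show thesis
  proof
    show "path \<gamma>" unfolding path_def by (rule cont)
    show "pathstart \<gamma> = r + exp (Complex x0 y0)"
      by (simp add: pathstart_def \<gamma>_def Q_def p_def)
    show "pathfinish \<gamma> = r + exp (Complex x1 (y0 + \<sigma> * (K x1 - K x0)))"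
      by (simp add: pathfinish_def \<gamma>_def Q_def p_def X_def)
    show "rectifiable \<gamma>" by (rule curve_length_le_potential_difference(1)[OF \<phi>dist])
    have "curve_length \<gamma> \<le> \<phi> 1 - \<phi> 0" by (rule curve_length_le_potential_difference(2)[OF \<phi>dist])
    then show "curve_length \<gamma> \<le> d * (K x1 - K x0) + (H x1 - H x0)"
      by (simp add: \<phi>_def p_def X_def)
    show "piecewise_smooth_away_from r \<gamma>"
      unfolding piecewise_smooth_away_from_def
    proof (intro allI impI)
      fix a b :: real assume ab: "0 \<le> a \<and> a < b \<and> b \<le> 1 \<and> r \<notin> \<gamma> ` {a..b}"
      have "smooth_between \<gamma> a b"
        unfolding smooth_between_def
      proof (intro exI[of _ \<gamma>'] conjI ballI)
        show "continuous_on {a..b} \<gamma>'" using cont' ab by (auto elim: continuous_on_subset)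
        fix t assume t: "t \<in> {a..b}"
        show "(\<gamma> has_vector_derivative \<gamma>' t) (at t within {a..b})"
          by (rule has_vector_derivative_at_within[OF d\<gamma>]) (use t ab in auto)
        have "norm (\<gamma>' t) > 0" unfolding n\<gamma>' using X cos_profile_pos[of "p t"] by simp
        then show "\<gamma>' t \<noteq> 0" by auto
      qed
      then show "piecewise_smooth_between \<gamma> a b"
        unfolding piecewise_smooth_between_def using subdivision_single[of a b] ab
        by (intro exI[of _ 1] exI[of _ "\<lambda>i. if i = 0 then a else b"]) simp
    qed
    show "angle_restricted \<alpha> r \<gamma>"
      unfolding angle_restricted_def
    proof (intro ballI allI impI)
      fix t D assume t: "t \<in> {0..1::real}" and D: "\<gamma> t \<noteq> r \<and> one_sided_tangent \<gamma> t D"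
      then obtain S where S: "side 0 1 t S" "(\<gamma> has_vector_derivative D) (at t within S)"
        unfolding one_sided_tangent_def side_def by auto
      have D: "D = \<gamma>' t"
        using vector_derivative_unique_within[OF side_nontrivial[OF S(1)] S(2)]
          has_vector_derivative_at_within[OF d\<gamma>[OF t]] by simp
      define c where "c = cos_profile \<alpha> d (p t)"
      have c: "cos \<alpha> \<le> c" "c > 0" "c \<le> 1"
        unfolding c_def by (rule cos_profile_ge cos_profile_pos cos_profile_le_one)+
      have "D \<bullet> (r - \<gamma> t) = - ((exp (Q t) * Q' t) \<bullet> exp (Q t))"
        by (simp add: D \<gamma>'_def \<gamma>_def)
      also have "\<dots> = (exp (p t))\<^sup>2 * X"
        unfolding inner_mult_self_complex by (simp add: Q_def Q'_def)
      finally have "(D \<bullet> (r - \<gamma> t)) / (norm D * norm (r - \<gamma> t)) = c"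
        using X c(2) by (simp add: D n\<gamma>' \<gamma>_def Q_def c_def[symmetric] power2_eq_square)
      moreover have "arccos c \<le> arccos (cos \<alpha>)"
        using c by (intro arccos_le_arccos) auto
      moreover have "arccos (cos \<alpha>) = \<alpha>" using \<alpha> by (intro arccos_cos) auto
      ultimately show "angle_between D (r - \<gamma> t) \<le> \<alpha>" unfolding angle_between_def by simp
    qed
  qed
qed

text \<open>In this region the tangent line of the curve stays at distance \<open>d\<close> from the root, so
  \<open>\<sigma> * Im q - arcsin (d * exp (- Re q))\<close> is a first integral.\<close>

lemma profile_line_segment:
  assumes \<sigma>: "\<sigma>\<^sup>2 = 1" and ab: "a < b" and cont: "continuous_on {a..b} q"
    and q: "\<And>t S. side a b t S \<Longrightarrow> \<exists>D. (q has_vector_derivative D) (at t within S) \<and>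
      Im D = - \<sigma> * tan_profile \<alpha> d (Re (q t)) * Re D"
    and le: "\<And>t. t \<in> {a..b} \<Longrightarrow> d * exp (- Re (q t)) \<le> sin \<alpha>"
    and g: "\<And>t. t \<in> {a..b} \<Longrightarrow> g t = r + exp (q t)"
    and ne: "Re (q a) \<noteq> Re (q b)"
  shows "line_segment (g ` {a..b})"
proof -
  define \<theta> where "\<theta> t = arcsin (d * exp (- Re (q t)))" for t
  define w where "w t = \<sigma> * Im (q t) - \<theta> t" for t
  have bounds: "0 \<le> d * exp (- Re (q t))" "d * exp (- Re (q t)) < 1" if "t \<in> {a..b}" for t
    using le[OF that] sin_less_one d by auto
  have w: "w t = w a" if t: "t \<in> {a..b}" for t
  proof (rule constant_if_side_derivatives_zero[of a t w])
    show "a \<le> t" using t by simp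
    fix u S assume S: "side a t u S"
    obtain S' where S': "side a b u S'" "S \<subseteq> S'" using side_subinterval[OF S order_refl, of b] t by auto
    from q[OF S'(1)] S'(2) obtain D where D: "(q has_vector_derivative D) (at u within S)"
      and ImD: "Im D = - \<sigma> * tan_profile \<alpha> d (Re (q u)) * Re D"
      using has_vector_derivative_within_subset by blast
    have u: "u \<in> {a..b}" using side_mem[OF S] t by auto
    define s where "s = d * exp (- Re (q u))"
    have s: "0 \<le> s" "s < 1" "s \<le> sin \<alpha>" unfolding s_def using bounds[OF u] le[OF u] by auto
    have "((\<lambda>t. \<sigma> * Im (q t) - arcsin (d * exp (- Re (q t)))) has_real_derivative
        \<sigma> * Im D - inverse (sqrt (1 - s\<^sup>2)) * (d * (exp (- Re (q u)) * - Re D))) (at u within S)"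
      unfolding s_def
      by (intro DERIV_diff DERIV_cmult DERIV_chain2[OF DERIV_arcsin] DERIV_chain2[OF DERIV_exp]
          DERIV_minus has_field_derivative_Im[OF D] has_field_derivative_Re[OF D])
        (use s in \<open>simp_all add: s_def\<close>)
    moreover have "\<sigma> * Im D - inverse (sqrt (1 - s\<^sup>2)) * (d * (exp (- Re (q u)) * - Re D)) = 0"
    proof -
      have "tan_profile \<alpha> d (Re (q u)) = s / sqrt (1 - s\<^sup>2)"
        using s(3) by (simp add: tan_profile_def cos_profile_def sin_profile_def s_def)
      then have "\<sigma> * Im D = - (\<sigma>\<^sup>2) * (s / sqrt (1 - s\<^sup>2)) * Re D"
        unfolding ImD by (simp add: power2_eq_square)
      then show ?thesis unfolding \<sigma> by (simp add: s_def field_simps)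
    qed
    ultimately show "(w has_vector_derivative 0) (at u within S)"
      unfolding w_def[abs_def] \<theta>_def has_real_derivative_iff_has_vector_derivative by simp
  qed
  \<comment> \<open>\<open>B\<close> is the unit direction of the line,
    \<open>r + B * (\<i> * \<sigma> * d)\<close> is the foot of the perpendicular from
    \<open>r\<close>, and \<open>h t\<close> is the position relative to that foot.\<close>
  define h where "h t = exp (Re (q t)) * cos (\<theta> t)" for t
  define B where "B = cis (\<sigma> * w a)"
  have "g t = (r + B * (\<i> * \<sigma> * d)) + of_real (h t) * B" if t: "t \<in> {a..b}" for t
  proof -
    have "sin (\<theta> t) = d * exp (- Re (q t))"
      unfolding \<theta>_def using bounds[OF t] by (intro sin_arcsin) auto
    then have dt: "exp (Re (q t)) * sin (\<theta> t) = d" by (simp add: exp_minus)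
    have "Im (q t) = \<sigma> * (w t + \<theta> t)" using \<sigma> by (simp add: w_def power2_eq_square mult.assoc[symmetric])
    then have Im: "Im (q t) = \<sigma> * w a + \<sigma> * \<theta> t" using w[OF t] by (simp add: distrib_left)
    have "\<sigma> = 1 \<or> \<sigma> = - 1" using \<sigma> by (simp add: power2_eq_1_iff)
    then have cis: "cis (\<sigma> * \<theta> t) = cos (\<theta> t) + \<i> * \<sigma> * sin (\<theta> t)"
      by (auto simp: complex_eq_iff)
    have "exp (q t) = of_real (exp (Re (q t))) * (B * cis (\<sigma> * \<theta> t))"
      unfolding exp_eq_polar[of "q t"] Im B_def cis_mult ..
    also have "\<dots> = B * (\<i> * \<sigma> * of_real (exp (Re (q t)) * sin (\<theta> t))) + of_real (h t) * B"
      unfolding cis h_def by (simp add: algebra_simps)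
    finally show ?thesis unfolding dt using g[OF t] by (simp add: algebra_simps)
  qed
  moreover have "continuous_on {a..b} h"
    unfolding h_def \<theta>_def using bounds
    by (intro continuous_intros cont ballI conjI) (auto intro: less_imp_le order_trans[of "-1" 0])
  moreover have "g a \<noteq> g b"
  proof
    assume "g a = g b"
    then have "norm (exp (q a)) = norm (exp (q b))" using g[of a] g[of b] ab by simp
    then show False using ne by simp
  qed
  ultimately show ?thesis using ab by (intro line_segment_image[of a b h]) auto
qed

text \<open>Here the profile sine is capped at \<open>sin \<alpha>\<close>, so the slope is constant
  and \<open>Im q + \<sigma> * tan \<alpha> * Re q\<close> is a first integral. The sign
  \<open>\<sigma>\<close> decides between the right and the left spiral.\<close>

lemma profile_spiral_segment:
  assumes \<sigma>: "\<sigma>\<^sup>2 = 1" and ab: "a < b" and cont: "continuous_on {a..b} q"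
    and q: "\<And>t S. side a b t S \<Longrightarrow> \<exists>D. (q has_vector_derivative D) (at t within S) \<and>
      Im D = - \<sigma> * tan_profile \<alpha> d (Re (q t)) * Re D"
    and ge: "\<And>t. t \<in> {a..b} \<Longrightarrow> sin \<alpha> \<le> d * exp (- Re (q t))"
    and g: "\<And>t. t \<in> {a..b} \<Longrightarrow> g t = r + exp (q t)"
    and decr: "\<And>s t. a \<le> s \<Longrightarrow> s < t \<Longrightarrow> t \<le> b \<Longrightarrow> Re (q t) < Re (q s)"
  shows "spiral_segment \<alpha> r (g ` {a..b})"
proof -
  have "\<sigma> = 1 \<or> \<sigma> = - 1" using \<sigma> by (simp add: power2_eq_1_iff)
  then have \<beta>: "\<sigma> * \<alpha> \<in> {\<alpha>, - \<alpha>}" "tan (\<sigma> * \<alpha>) = \<sigma> * tan \<alpha>" by auto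
  define w where "w t = Im (q t) + \<sigma> * tan \<alpha> * Re (q t)" for t
  have w: "w t = w a" if t: "t \<in> {a..b}" for t
  proof (rule constant_if_side_derivatives_zero[of a t w])
    show "a \<le> t" using t by simp
    fix u S assume S: "side a t u S"
    obtain S' where S': "side a b u S'" "S \<subseteq> S'" using side_subinterval[OF S order_refl, of b] t by auto
    from q[OF S'(1)] S'(2) obtain D where D: "(q has_vector_derivative D) (at u within S)"
      and ImD: "Im D = - \<sigma> * tan_profile \<alpha> d (Re (q u)) * Re D"
      using has_vector_derivative_within_subset by blast
    have u: "u \<in> {a..b}" using side_mem[OF S] t by auto
    have "(w has_real_derivative Im D + \<sigma> * tan \<alpha> * Re D) (at u within S)"
      unfolding w_def[abs_def] by (intro DERIV_add DERIV_cmult has_field_derivative_Im[OF D] has_field_derivative_Re[OF D])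
    then show "(w has_vector_derivative 0) (at u within S)"
      unfolding has_real_derivative_iff_has_vector_derivative ImD
      using tan_profile_spiral[OF ge[OF u]] by simp
  qed
  have "Im (q t) - Im (q a) = - tan (\<sigma> * \<alpha>) * (Re (q t) - Re (q a))" if "t \<in> {a..b}" for t
  proof -
    have "Im (q t) + \<sigma> * tan \<alpha> * Re (q t) = Im (q a) + \<sigma> * tan \<alpha> * Re (q a)"
      using w[OF that] by (simp only: w_def)
    then show ?thesis unfolding \<beta>(2) by (simp add: algebra_simps)
  qed
  from spiral_segment_image[OF cont ab g this decr \<beta>(1)] show ?thesis by simp
qed

end

section \<open>Shortest curves\<close>

text \<open>Integrating over a slightly larger interval gives two-sided derivatives also at
  \<open>a\<close> and \<open>b\<close>, as the chain rule along a curve requires.\<close>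

lemma exists_antiderivative:
  fixes f :: "real \<Rightarrow> real"
  assumes "continuous_on UNIV f"
  obtains F where "\<And>x. x \<in> {a..b} \<Longrightarrow> (F has_real_derivative f x) (at x)"
proof -
  have "continuous_on {a - 1..b + 1} f" using assms continuous_on_subset by blast
  from antiderivative_continuous[OF this] obtain F where
    F: "\<And>x. x \<in> {a - 1..b + 1} \<Longrightarrow> (F has_vector_derivative f x) (at x within {a - 1..b + 1})"
    by blast
  show thesis
  proof
    fix x assume x: "x \<in> {a..b}"
    then have "at x within {a - 1..b + 1} = at x" by (intro at_within_Icc_at) auto
    with F[of x] x show "(F has_real_derivative f x) (at x)"
      by (simp add: has_real_derivative_iff_has_vector_derivative)
  qed
qed

text \<open>Division by the position vector \<open>E\<close> takes the tangent \<open>E * D\<close>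
  to \<open>D\<close> and the direction to the root to -1. The restriction thus says that
  \<open>D\<close> lies in the cone of half-angle \<open>\<alpha>\<close> around the negative real
  axis.\<close>

lemma angle_condition_logarithmic:
  assumes \<alpha>: "0 < \<alpha>" "\<alpha> < pi / 2" and "D \<noteq> 0"
    and "cos \<alpha> * (norm (E * D) * norm E) \<le> (E * D) \<bullet> (- E)" "E \<noteq> 0"
  shows "Re D < 0" "\<bar>Im D\<bar> \<le> - tan \<alpha> * Re D"
proof -
  have c: "cos \<alpha> > 0" and s: "sin \<alpha> > 0" using \<alpha> by (simp_all add: cos_gt_zero sin_gt_zero)
  have "(norm E)\<^sup>2 * (cos \<alpha> * norm D) \<le> (norm E)\<^sup>2 * - Re D"
    using assms(4) unfolding inner_minus_right inner_mult_self_complex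
    by (simp add: norm_mult power2_eq_square mult_ac)
  then have le: "cos \<alpha> * norm D \<le> - Re D"
    by (rule mult_left_le_imp_le) (use assms(5) in simp)
  have "0 < cos \<alpha> * norm D" using c assms(3) by simp
  with le show neg: "Re D < 0" by linarith
  have "(cos \<alpha> * norm D)\<^sup>2 \<le> (- Re D)\<^sup>2"
    using le c by (intro power_mono) auto
  then have "(cos \<alpha>)\<^sup>2 * (Im D)\<^sup>2 \<le> (1 - (cos \<alpha>)\<^sup>2) * (Re D)\<^sup>2"
    by (simp add: power_mult_distrib cmod_power2 algebra_simps)
  then have "(cos \<alpha> * \<bar>Im D\<bar>)\<^sup>2 \<le> (sin \<alpha> * - Re D)\<^sup>2"
    by (simp add: power_mult_distrib sin_squared_eq)
  then have "cos \<alpha> * \<bar>Im D\<bar> \<le> sin \<alpha> * - Re D"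
    by (rule power2_le_imp_le) (use neg s in \<open>simp add: mult_nonneg_nonpos\<close>)
  then show "\<bar>Im D\<bar> \<le> - tan \<alpha> * Re D" using c by (simp add: tan_def field_simps)
qed

lemma consists_of_one_segment:
  "line_segment (g ` {0..1}) \<or> spiral_segment \<alpha> r (g ` {0..1}) \<Longrightarrow> consists_of_segments \<alpha> r g"
  unfolding consists_of_segments_def
  by (rule exI[of _ 1], rule exI[of _ "\<lambda>i. if i = 0 then 0 else 1"]) (simp add: subdivision_def)

text \<open>The inscribed polygon with the single inner vertex \<open>g t\<close> is no longer than
  the chord, so the triangle inequality is an equality and \<open>g t\<close> lies on the
  chord.\<close>

lemma shortest_curve_to_root:
  assumes "rectifiable g" "path g" "pathstart g \<noteq> r" "pathfinish g = r"
    and len: "curve_length g \<le> dist (pathstart g) r"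
  shows "line_segment (g ` {0..1})"
proof -
  define v where "v = pathstart g"
  define B where "B = (v - r) / of_real (norm (v - r))"
  have v: "v \<noteq> r" "g 0 = v" "g 1 = r" using assms by (auto simp: v_def pathstart_def pathfinish_def)
  then have nv: "of_real (norm (v - r)) * B = v - r" by (simp add: B_def)
  have "g t = r + of_real (norm (g t - r)) * B" if t: "t \<in> {0..1}" for t
  proof (cases "t = 0 \<or> t = 1")
    case True
    then show ?thesis using v nv by auto
  next
    case False
    then have "subdivision 0 1 2 (\<lambda>i. if i = 0 then 0 else if i = 1 then t else 1)"
      using t by (auto simp: subdivision_def less_2_cases_iff)
    from polygonal_length_le_curve_length[OF assms(1) this]
    have "dist v (g t) + dist (g t) r \<le> curve_length g"
      using v by (simp add: numeral_2_eq_2)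
    then have eq: "norm ((v - g t) + (g t - r)) = norm (v - g t) + norm (g t - r)"
      using len norm_triangle_ineq[of "v - g t" "g t - r"] by (simp add: v_def dist_norm)
    then have "norm (v - g t) *\<^sub>R (g t - r) = norm (g t - r) *\<^sub>R (v - g t)"
      by (rule norm_triangle_eq[THEN iffD1])
    then have "(norm (v - g t) + norm (g t - r)) *\<^sub>R (g t - r) = norm (g t - r) *\<^sub>R (v - r)"
      by (simp add: algebra_simps)
    then have "norm (v - r) *\<^sub>R (g t - r) = norm (g t - r) *\<^sub>R (v - r)" using eq by simp
    also have "\<dots> = norm (g t - r) *\<^sub>R (of_real (norm (v - r)) * B)" by (simp only: nv)
    also have "\<dots> = norm (v - r) *\<^sub>R (norm (g t - r) * B)" by (simp add: scaleR_conv_of_real)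
    finally have "g t - r = norm (g t - r) * B" using v(1) by (simp add: scaleR_cancel_left)
    then show ?thesis by (simp add: algebra_simps)
  qed
  moreover have "continuous_on {0..1} (\<lambda>t. norm (g t - r))"
    using assms(2) unfolding path_def by (intro continuous_intros)
  ultimately show ?thesis
    using v by (intro line_segment_image[of 0 1 "\<lambda>t. norm (g t - r)" g r B]) auto
qed

text \<open>The competitor for arcs into the root: its tangent points at \<open>r\<close>
  everywhere, so the angle is 0.\<close>

lemma linepath_to_root:
  assumes "v \<noteq> r" "0 \<le> \<alpha>"
  shows "rectifiable (linepath v r)" "curve_length (linepath v r) \<le> dist v r"
    "piecewise_smooth_away_from r (linepath v r)" "angle_restricted \<alpha> r (linepath v r)"
proof -
  have *: "dist (linepath v r x) (linepath v r y) \<le> dist v r * y - dist v r * x" if "x < y" for x y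
  proof -
    have "linepath v r y - linepath v r x = (y - x) *\<^sub>R (r - v)"
      by (simp add: linepath_def algebra_simps)
    then have "dist (linepath v r x) (linepath v r y) = norm ((y - x) *\<^sub>R (r - v))"
      by (metis dist_norm dist_commute)
    then show ?thesis using that by (simp add: dist_norm norm_minus_commute[of r] left_diff_distrib)
  qed
  show "rectifiable (linepath v r)"
    by (rule curve_length_le_potential_difference(1)[of _ "\<lambda>x. dist v r * x"]) (rule *)
  show "curve_length (linepath v r) \<le> dist v r"
    using curve_length_le_potential_difference(2)[of "linepath v r" "\<lambda>x. dist v r * x"] * by simp
  have der: "(linepath v r has_vector_derivative r - v) (at t within S)" for t S
    by (rule has_vector_derivative_linepath_within)
  show "piecewise_smooth_away_from r (linepath v r)"
    unfolding piecewise_smooth_away_from_def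
  proof (intro allI impI)
    fix a b :: real assume ab: "0 \<le> a \<and> a < b \<and> b \<le> 1 \<and> r \<notin> linepath v r ` {a..b}"
    have "smooth_between (linepath v r) a b"
      unfolding smooth_between_def
      by (rule exI[of _ "\<lambda>_. r - v"]) (use assms(1) der in \<open>auto intro: continuous_on_const\<close>)
    then show "piecewise_smooth_between (linepath v r) a b"
      unfolding piecewise_smooth_between_def using subdivision_single[of a b] ab
      by (intro exI[of _ 1] exI[of _ "\<lambda>i. if i = 0 then a else b"]) simp
  qed
  show "angle_restricted \<alpha> r (linepath v r)"
    unfolding angle_restricted_def
  proof (intro ballI allI impI)
    fix t D assume t: "t \<in> {0..1::real}" and D: "linepath v r t \<noteq> r \<and> one_sided_tangent (linepath v r) t D"
    then obtain S where S: "side 0 1 t S" "(linepath v r has_vector_derivative D) (at t within S)"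
      unfolding one_sided_tangent_def side_def by auto
    have D': "D = r - v"
      using vector_derivative_unique_within[OF side_nontrivial[OF S(1)] S(2) der] .
    have L: "r - linepath v r t = (1 - t) *\<^sub>R (r - v)" by (simp add: linepath_def algebra_simps)
    have "t \<noteq> 1" using D by (auto simp: linepath_def)
    then have "1 - t > 0" using t by simp
    moreover have "norm (r - v) > 0" using assms(1) by simp
    ultimately have cos_angle: "(D \<bullet> (r - linepath v r t)) / (norm D * norm (r - linepath v r t)) = 1"
      unfolding L D' by (simp add: power2_norm_eq_inner[symmetric] power2_eq_square)
    then show "angle_between D (r - linepath v r t) \<le> \<alpha>"
      unfolding angle_between_def cos_angle using assms(2) by simp
  qed
qed

lemma shortest_curve_consists_of_segments:
  assumes \<alpha>: "0 < \<alpha>" "\<alpha> < pi / 2"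
    and g: "path g" "rectifiable g" "piecewise_smooth_away_from r g" "angle_restricted \<alpha> r g"
    and finish: "pathfinish g \<noteq> r"
    and shortest: "\<And>\<gamma>. path \<gamma> \<Longrightarrow> pathstart \<gamma> = pathstart g \<Longrightarrow> pathfinish \<gamma> = pathfinish g \<Longrightarrow>
      rectifiable \<gamma> \<Longrightarrow> piecewise_smooth_away_from r \<gamma> \<Longrightarrow> angle_restricted \<alpha> r \<gamma> \<Longrightarrow>
      curve_length g \<le> curve_length \<gamma>"
  shows "consists_of_segments \<alpha> r g"
proof -
  have nr: "g t \<noteq> r" if "t \<in> {0..1}" for t
    using angle_restricted_avoids_root[OF g(1,3,4)] \<alpha> finish that by (simp add: pathfinish_def)
  have contg: "continuous_on {0..1} g" using g(1) by (simp add: path_def)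
  then have "continuous_on {0..1} (\<lambda>t. g t - r)" by (intro continuous_intros)
  moreover have "contractible {0..1::real}" by (intro convex_imp_contractible) simp
  \<comment> \<open>The imaginary part of this lift is a continuous polar angle, not reduced modulo
    a full turn, so the total turn of \<open>g\<close> is well defined.\<close>
  ultimately obtain q where q: "continuous_on {0..1} q" "\<And>t. t \<in> {0..1} \<Longrightarrow> g t - r = exp (q t)"
    using continuous_logarithm_on_contractible[of "{0..1}" "\<lambda>t. g t - r"] nr by auto
  have gq: "g t = r + exp (q t)" if "t \<in> {0..1}" for t using q(2)[OF that] by (simp add: algebra_simps)
  have "r \<notin> g ` {0..1}" using nr by blast
  then have pws: "piecewise_smooth_between g 0 1"
    using g(3)[unfolded piecewise_smooth_away_from_def, rule_format, of 0 1] by simp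
  have der: "\<exists>D. (q has_vector_derivative D) (at t within S) \<and>
      (g has_vector_derivative exp (q t) * D) (at t within S) \<and>
      Re D < 0 \<and> \<bar>Im D\<bar> \<le> - tan \<alpha> * Re D" if S: "side 0 1 t S" for t S
  proof -
    obtain d where d: "d \<noteq> 0" "(g has_vector_derivative d) (at t within S)"
      using piecewise_smooth_between_imp_side_derivative[OF pws S] .
    have t: "t \<in> {0..1}" "t \<in> S" "S \<subseteq> {0..1}" using S by (auto simp: side_def)
    define D where "D = d / exp (q t)"
    have dD: "d = exp (q t) * D" by (simp add: D_def)
    have "((\<lambda>t. g t - r) has_vector_derivative d) (at t within S)"
      using d(2) by (auto intro!: derivative_eq_intros)
    from has_vector_derivative_logarithm[OF q t(2,3) this]
    have "(q has_vector_derivative D) (at t within S)" by (simp add: D_def q(2)[OF t(1)])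
    moreover have "D \<noteq> 0" using d(1) by (simp add: dD)
    moreover have "cos \<alpha> * (norm (exp (q t) * D) * norm (exp (q t))) \<le> (exp (q t) * D) \<bullet> (- exp (q t))"
      using angle_restricted_imp_inner_ge[OF g(4) _ _ S d(2) nr[OF t(1)]] \<alpha>
      unfolding dD[symmetric] by (simp add: gq[OF t(1)])
    ultimately show ?thesis
      using angle_condition_logarithmic[OF \<alpha>, of D "exp (q t)"] d(2) dD by auto
  qed
  have decr: "Re (q t) < Re (q s)" if st: "0 \<le> s" "s < t" "t \<le> 1" for s t
  proof (rule strict_decreasing_if_side_derivatives_neg[OF st(2)])
    fix u S assume S: "side s t u S"
    obtain S' where S': "side 0 1 u S'" "S \<subseteq> S'" using side_subinterval[OF S st(1,3)] .
    from der[OF S'(1)] S'(2) obtain D where "(q has_vector_derivative D) (at u within S)" "Re D < 0"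
      using has_vector_derivative_within_subset by blast
    then show "\<exists>D<0. ((\<lambda>u. Re (q u)) has_vector_derivative D) (at u within S)"
      using has_field_derivative_Re has_real_derivative_iff_has_vector_derivative by blast
  qed
  define x0 x1 where "x0 = Re (q 0)" "x1 = Re (q 1)"
  note x_defs = this
  have x10: "x1 < x0" unfolding x_defs by (rule decr) auto
  have xt: "Re (q t) \<in> {x1..x0}" if "t \<in> {0..1}" for t
  proof -
    have "Re (q t) \<le> Re (q 0)" using decr[of 0 t] that by (cases "t = 0") auto
    moreover have "Re (q 1) \<le> Re (q t)" using decr[of t 1] that by (cases "t = 1") auto
    ultimately show ?thesis by (simp add: x_defs)
  qed
  \<comment> \<open>Direction and size of the net turn. The comparison curve turns in this direction
    only, although \<open>g\<close> might a priori turn both ways.\<close>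
  define \<sigma> :: real where "\<sigma> = (if Im (q 0) \<le> Im (q 1) then 1 else - 1)"
  define \<Delta> where "\<Delta> = \<bar>Im (q 1) - Im (q 0)\<bar>"
  have \<sigma>: "\<sigma>\<^sup>2 = 1" and \<sigma>\<Delta>: "\<sigma> * \<Delta> = Im (q 1) - Im (q 0)" by (auto simp: \<sigma>_def \<Delta>_def)
  \<comment> \<open>Integrating the cone condition with either sign shows that the net turn is
    within the range that some profile attains.\<close>
  have bound: "s * (Im (q 1) - Im (q 0)) \<le> tan \<alpha> * (x0 - x1)" if s: "\<bar>s\<bar> = 1" for s
  proof -
    have "s * Im (q 1) + tan \<alpha> * Re (q 1) \<le> s * Im (q 0) + tan \<alpha> * Re (q 0)"
    proof (rule decreasing_if_side_derivatives_nonpos[of 0 1 "\<lambda>t. s * Im (q t) + tan \<alpha> * Re (q t)"])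
      fix t S assume "side 0 1 t S"
      from der[OF this] obtain D where D: "(q has_vector_derivative D) (at t within S)"
        "\<bar>Im D\<bar> \<le> - tan \<alpha> * Re D" by blast
      have "s * Im D \<le> \<bar>Im D\<bar>" using s by (metis abs_ge_self abs_mult mult_1)
      moreover have "((\<lambda>t. s * Im (q t) + tan \<alpha> * Re (q t)) has_real_derivative s * Im D + tan \<alpha> * Re D) (at t within S)"
        by (intro DERIV_add DERIV_cmult has_field_derivative_Im[OF D(1)] has_field_derivative_Re[OF D(1)])
      ultimately show "\<exists>E\<le>0. ((\<lambda>t. s * Im (q t) + tan \<alpha> * Re (q t)) has_vector_derivative E) (at t within S)"
        using D(2) unfolding has_real_derivative_iff_has_vector_derivative
        by (intro exI[of _ "s * Im D + tan \<alpha> * Re D"]) simp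
    qed simp
    then show ?thesis by (simp add: x_defs algebra_simps)
  qed
  have "\<Delta> \<le> tan \<alpha> * (x0 - x1)" using bound[of 1] bound[of "- 1"] by (simp add: \<Delta>_def)
  moreover have "0 \<le> \<Delta>" by (simp add: \<Delta>_def)
  ultimately obtain d where d_props: "0 \<le> d" "integral {x1..x0} (tan_profile \<alpha> d) = \<Delta>"
    using exists_profile[OF \<alpha> less_imp_le[OF x10]] by blast
  interpret profile \<alpha> d using \<alpha> d_props(1) by unfold_locales
  have "continuous_on UNIV (\<lambda>x. - tan_profile \<alpha> d x)"
    by (intro continuous_intros continuous_profile)
  then obtain K where K: "\<And>x. x \<in> {x1..x0} \<Longrightarrow> (K has_real_derivative - tan_profile \<alpha> d x) (at x)"
    using exists_antiderivative by blast
  \<comment> \<open>The coefficient of \<open>Re D\<close> in the calibration inequality depends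
    only on the logarithmic distance, and that of \<open>Im D\<close> is constant. Hence the
    inequality is the derivative of a potential, with \<open>H\<close> as its radial part.\<close>
  have "continuous_on UNIV (\<lambda>x. d * tan_profile \<alpha> d x - exp x / cos_profile \<alpha> d x)"
    using cos_profile_pos by (intro continuous_intros continuous_profile ballI) (metis less_irrefl)
  then obtain H where H: "\<And>x. x \<in> {x1..x0} \<Longrightarrow>
      (H has_real_derivative d * tan_profile \<alpha> d x - exp x / cos_profile \<alpha> d x) (at x)"
    using exists_antiderivative by blast
  have "((\<lambda>x. - tan_profile \<alpha> d x) has_integral K x0 - K x1) {x1..x0}"
  proof (rule fundamental_theorem_of_calculus)
    fix x assume "x \<in> {x1..x0}"
    from has_field_derivative_at_within[OF K[OF this]]
    show "(K has_vector_derivative - tan_profile \<alpha> d x) (at x within {x1..x0})"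
      by (simp add: has_real_derivative_iff_has_vector_derivative)
  qed (use x10 in simp)
  then have "integral {x1..x0} (\<lambda>x. - tan_profile \<alpha> d x) = K x0 - K x1" by (rule integral_unique)
  \<comment> \<open>By the choice of \<open>d\<close> the comparison curve turns by exactly the net
    turn of \<open>g\<close>, so both curves end at the same point.\<close>
  then have K\<Delta>: "K x1 - K x0 = \<Delta>" using d_props(2) by simp
  define F where "F t = \<sigma> * d * Im (q t) + H (Re (q t))" for t
  \<comment> \<open>The increase of \<open>F\<close> depends only on the ends of \<open>q\<close>,
    so the length bound for the comparison curve passes to the shortest curve
    \<open>g\<close>.\<close>
  have "curve_length g \<le> F 1 - F 0"
  proof -
    obtain \<gamma> where \<gamma>: "path \<gamma>" "pathstart \<gamma> = r + exp (Complex x0 (Im (q 0)))"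
      "pathfinish \<gamma> = r + exp (Complex x1 (Im (q 0) + \<sigma> * (K x1 - K x0)))"
      "rectifiable \<gamma>" "piecewise_smooth_away_from r \<gamma>" "angle_restricted \<alpha> r \<gamma>"
      "curve_length \<gamma> \<le> d * (K x1 - K x0) + (H x1 - H x0)"
      using comparison_curve[OF \<sigma> x10 K H] by blast
    have "pathstart \<gamma> = pathstart g" using \<gamma>(2) gq[of 0] by (simp add: pathstart_def x_defs)
    moreover have "pathfinish \<gamma> = pathfinish g"
      using \<gamma>(3) gq[of 1] unfolding K\<Delta> \<sigma>\<Delta> by (simp add: pathfinish_def x_defs)
    ultimately have "curve_length g \<le> curve_length \<gamma>" using shortest \<gamma> by blast
    also have "\<dots> \<le> d * \<Delta> + (H x1 - H x0)" using \<gamma>(7) unfolding K\<Delta> .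
    also have "\<Delta> = \<sigma> * (Im (q 1) - Im (q 0))"
      using \<sigma> unfolding \<sigma>\<Delta>[symmetric] by (simp add: power2_eq_square mult.assoc[symmetric])
    finally show ?thesis by (simp add: F_def x_defs algebra_simps)
  qed
  have derF: "(F has_vector_derivative \<sigma> * d * Im D +
      (d * tan_profile \<alpha> d (Re (q t)) - exp (Re (q t)) / cos_profile \<alpha> d (Re (q t))) * Re D) (at t within S)"
    if "t \<in> {0..1}" "(q has_vector_derivative D) (at t within S)" for t S D
    unfolding F_def[abs_def] has_real_derivative_iff_has_vector_derivative[symmetric]
    by (intro DERIV_add DERIV_cmult DERIV_chain2[where g = "\<lambda>t. Re (q t)"] H[OF xt[OF that(1)]]
        has_field_derivative_Im[OF that(2)] has_field_derivative_Re[OF that(2)])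
  have dist_le: "dist (g x) (g y) \<le> F y - F x" if "0 \<le> x" "x < y" "y \<le> 1" for x y
  proof (rule dist_le_potential_difference[OF g(2) \<open>curve_length g \<le> F 1 - F 0\<close> _ that])
    fix t S assume S: "side 0 1 t S"
    from der[OF S] obtain D where D: "(q has_vector_derivative D) (at t within S)"
      "(g has_vector_derivative exp (q t) * D) (at t within S)" "\<bar>Im D\<bar> \<le> - tan \<alpha> * Re D" by blast
    show "\<exists>D d. (F has_vector_derivative D) (at t within S) \<and>
        (g has_vector_derivative d) (at t within S) \<and> D \<le> norm d"
      using derF[OF side_mem[OF S] D(1)] D(2) calibration_le[OF \<sigma> D(3), of "Re (q t)"]
      by (intro exI conjI) (auto simp: norm_mult)
  qed
  have slope: "\<exists>D. (q has_vector_derivative D) (at t within S) \<and>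
      Im D = - \<sigma> * tan_profile \<alpha> d (Re (q t)) * Re D" if S: "side 0 1 t S" for t S
  proof -
    from der[OF S] obtain D where D: "(q has_vector_derivative D) (at t within S)"
      "(g has_vector_derivative exp (q t) * D) (at t within S)" "\<bar>Im D\<bar> \<le> - tan \<alpha> * Re D" by blast
    \<comment> \<open>Differentiating \<open>dist_le\<close> reverses the calibration inequality at
      every one-sided tangent, and the equality case determines the slope.\<close>
    have "norm (exp (q t) * D) \<le> \<sigma> * d * Im D +
      (d * tan_profile \<alpha> d (Re (q t)) - exp (Re (q t)) / cos_profile \<alpha> d (Re (q t))) * Re D"
      using dist_le
      by (intro norm_derivative_le_if_dist_le[OF S derF[OF side_mem[OF S] D(1)] D(2)])
        (simp add: dist_norm norm_minus_commute)
    then have "Im D = - \<sigma> * tan_profile \<alpha> d (Re (q t)) * Re D"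
      by (intro calibration_eq[OF \<sigma> D(3)]) (simp add: norm_mult)
    with D(1) show ?thesis by blast
  qed
  have slope_sub: "\<exists>D. (q has_vector_derivative D) (at t within S) \<and>
      Im D = - \<sigma> * tan_profile \<alpha> d (Re (q t)) * Re D"
    if S: "side a b t S" "0 \<le> a" "b \<le> 1" for a b t S
  proof -
    from side_subinterval[OF S] obtain S' where S': "side 0 1 t S'" "S \<subseteq> S'" .
    from slope[OF S'(1)] S'(2) show ?thesis using has_vector_derivative_within_subset by blast
  qed
  \<comment> \<open>The uncapped sine of the profile. It never decreases along \<open>g\<close>, so
    \<open>g\<close> changes at most once, from the straight to the spiral regime, where this value
    passes \<open>sin \<alpha>\<close>.\<close>
  define \<psi> where "\<psi> t = d * exp (- Re (q t))" for t
  have \<psi>_mono: "\<psi> s \<le> \<psi> t" if "0 \<le> s" "s \<le> t" "t \<le> 1" for s t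
    using decr[of s t] that d_props(1) unfolding \<psi>_def by (cases "s = t") (auto intro!: mult_left_mono)
  have cont_sub: "continuous_on {a..b} q" if "0 \<le> a" "b \<le> 1" for a b
    using q(1) that by (auto elim: continuous_on_subset)
  have line: "line_segment (g ` {a..b})" if ab: "0 \<le> a" "a < b" "b \<le> 1" and le: "\<psi> b \<le> sin \<alpha>" for a b
  proof (rule profile_line_segment[OF \<sigma> ab(2) cont_sub[OF ab(1,3)], where r = r])
    show "\<exists>D. (q has_vector_derivative D) (at t within S) \<and>
        Im D = - \<sigma> * tan_profile \<alpha> d (Re (q t)) * Re D" if "side a b t S" for t S
      using slope_sub[OF that ab(1,3)] .
    show "d * exp (- Re (q t)) \<le> sin \<alpha>" if "t \<in> {a..b}" for t
      using \<psi>_mono[of t b] le ab that by (simp add: \<psi>_def)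
    show "g t = r + exp (q t)" if "t \<in> {a..b}" for t using gq ab that by simp
    show "Re (q a) \<noteq> Re (q b)" using decr[OF ab] by simp
  qed
  have spiral: "spiral_segment \<alpha> r (g ` {a..b})"
    if ab: "0 \<le> a" "a < b" "b \<le> 1" and le: "sin \<alpha> \<le> \<psi> a" for a b
  proof (rule profile_spiral_segment[OF \<sigma> ab(2) cont_sub[OF ab(1,3)]])
    show "\<exists>D. (q has_vector_derivative D) (at t within S) \<and>
        Im D = - \<sigma> * tan_profile \<alpha> d (Re (q t)) * Re D" if "side a b t S" for t S
      using slope_sub[OF that ab(1,3)] .
    show "sin \<alpha> \<le> d * exp (- Re (q t))" if "t \<in> {a..b}" for t
      using \<psi>_mono[of a t] le ab that by (simp add: \<psi>_def)
    show "g t = r + exp (q t)" if "t \<in> {a..b}" for t using gq ab that by simp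
    show "Re (q t) < Re (q s)" if "a \<le> s" "s < t" "t \<le> b" for s t
      using decr[of s t] that ab by simp
  qed
  \<comment> \<open>If the threshold is not passed strictly inside, one segment suffices. Otherwise
    both pieces have positive parameter length, as a subdivision demands.\<close>
  consider "\<psi> 1 \<le> sin \<alpha>" | "sin \<alpha> \<le> \<psi> 0" | "\<psi> 0 < sin \<alpha>" "sin \<alpha> < \<psi> 1" by linarith
  then show ?thesis
  proof cases
    case 1
    then show ?thesis using line[of 0 1] consists_of_one_segment by simp
  next
    case 2
    then show ?thesis using spiral[of 0 1] consists_of_one_segment by simp
  next
    case 3
    have "continuous_on {0..1} \<psi>" unfolding \<psi>_def by (intro continuous_intros q(1))
    then obtain u where u: "0 \<le> u" "u \<le> 1" "\<psi> u = sin \<alpha>"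
      using IVT'[of \<psi> 0 "sin \<alpha>" 1] 3 by auto
    have u01: "0 < u" "u < 1" using u 3 by (auto simp: less_le)
    define s where "s i = (if i = 0 then 0 else if i = 1 then u else 1)" for i :: nat
    have s: "s 0 = 0" "s (Suc 0) = u" "s (Suc (Suc 0)) = 1" by (simp_all add: s_def)
    have "subdivision 0 1 (Suc (Suc 0)) s"
      unfolding subdivision_def using u01 s by (auto simp: less_Suc_eq)
    moreover have "\<forall>i<Suc (Suc 0). line_segment (g ` {s i..s (Suc i)}) \<or> spiral_segment \<alpha> r (g ` {s i..s (Suc i)})"
      using line[of 0 u] spiral[of u 1] u u01 s by (auto simp: less_Suc_eq)
    ultimately show ?thesis unfolding consists_of_segments_def by blast
  qed
qed

text \<open>\<open>flux_tree\<close> constrains each drawn arc separately, so redrawing one arc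
  between the same ends gives another flux tree whose length differs in that single summand.\<close>

lemma optimal_flux_tree_arc_shortest:
  assumes opt: "optimal_flux_tree \<alpha> r T V E c" and e: "(v, w) \<in> E"
    and \<gamma>: "path \<gamma>" "pathstart \<gamma> = v" "pathfinish \<gamma> = w" "rectifiable \<gamma>"
      "piecewise_smooth_away_from r \<gamma>" "angle_restricted \<alpha> r \<gamma>"
  shows "curve_length (c (v, w)) \<le> curve_length \<gamma>"
proof -
  have ft: "flux_tree \<alpha> r T V E c" using opt by (simp add: optimal_flux_tree_def)
  then have "finite V" "E \<subseteq> V \<times> V" by (auto simp: flux_tree_def tree_towards_def)
  then have fin: "finite E" by (meson finite_SigmaI finite_subset)
  have "flux_tree \<alpha> r T V E (c((v, w) := \<gamma>))"
    using ft \<gamma> unfolding flux_tree_def by auto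
  then have "tree_length E c \<le> tree_length E (c((v, w) := \<gamma>))"
    using opt unfolding optimal_flux_tree_def by blast
  moreover have "(\<Sum>e\<in>E - {(v, w)}. curve_length ((c((v, w) := \<gamma>)) e)) = (\<Sum>e\<in>E - {(v, w)}. curve_length (c e))"
    by (intro sum.cong) auto
  ultimately show ?thesis
    unfolding tree_length_def sum.remove[OF fin e] by simp
qed

theorem mainTheorem1:
  fixes r :: complex and t :: "nat \<Rightarrow> complex" and n :: nat and \<alpha> :: real
    and V :: "complex set" and E :: "(complex \<times> complex) set"
    and c :: "complex \<times> complex \<Rightarrow> real \<Rightarrow> complex"
  assumes "0 < \<alpha>" and "\<alpha> < pi / 2"
    and "optimal_flux_tree \<alpha> r (t ` {1..n}) V E c"
  shows "\<forall>e\<in>E. consists_of_segments \<alpha> r (c e)"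
proof
  fix e assume "e \<in> E"
  then obtain v w where e: "e = (v, w)" "(v, w) \<in> E" by (cases e) auto
  have ft: "flux_tree \<alpha> r (t ` {1..n}) V E c" using assms(3) by (simp add: optimal_flux_tree_def)
  then have "v \<noteq> r" using e(2) by (auto simp: flux_tree_def tree_towards_def)
  have c: "path (c e)" "pathstart (c e) = v" "pathfinish (c e) = w" "rectifiable (c e)"
    "piecewise_smooth_away_from r (c e)" "angle_restricted \<alpha> r (c e)"
    using ft e unfolding flux_tree_def by auto
  note shortest = optimal_flux_tree_arc_shortest[OF assms(3) e(2), folded e(1)]
  show "consists_of_segments \<alpha> r (c e)"
  \<comment> \<open>An arc into the root has no logarithm at its end, so it is compared with its
    chord instead.\<close>
  proof (cases "w = r")
    case True
    note line = linepath_to_root[OF \<open>v \<noteq> r\<close> less_imp_le[OF assms(1)]]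
    have "curve_length (c e) \<le> curve_length (linepath v r)"
      by (rule shortest) (use True line in auto)
    also have "\<dots> \<le> dist v r" by (rule line)
    finally have "line_segment (c e ` {0..1})"
      using c True \<open>v \<noteq> r\<close> by (intro shortest_curve_to_root[of _ r]) auto
    then show ?thesis using consists_of_one_segment by blast
  next
    case False
    then show ?thesis
      using c shortest by (intro shortest_curve_consists_of_segments[OF assms(1,2)]) auto
  qed
qed

end
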